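(* As formal power series in a variable $x$ (with coefficients meromorphic functions of $(z,\tau)$), \[ \sum_{n \geq 0} \frac{J_n(z,\tau)}{n !} x^n = x \cdot \theta_1^\bullet(0, \tau) \cdot \frac{ \exp(x \partial_z) \cdot \theta_1(z,\tau) }{ \theta_1(\frac{x}{2 \pi i},\tau)\, \theta_1(z,\tau) }, \] where $\partial_z = \frac{1}{2 \pi i} \frac{\partial}{\partial z}$, $\exp(x \partial_z) \cdot \theta_1(z,\tau) := \sum_{k \geq 0} \frac{x^k}{k!} \partial_z^k( \theta_1(z,\tau) )$, and $x\,\theta_1^\bullet(0,\tau)/\theta_1(\frac{x}{2\pi i},\tau)$ is expanded as a power series in $x$.
   Context: Let $\tau\in\mathbb{H}$, $z\in\mathbb{C}$, $q=e^{2\pi i\tau}$, $p=e^{2\pi iz}$, $q^{1/8}=e^{\pi i\tau/4}$, $p^{1/2}=e^{\pi i z}$. $\theta_1(z,\tau) = -i q^{1/8} (p^{1/2} - p^{-1/2}) \prod_{m \geq 1} (1 - q^m) (1 - p q^m) (1 - p^{-1} q^m)$, and $\theta_1^\bullet=\frac{1}{2\pi i}\frac{\partial\theta_1}{\partial z}$. Bernoulli numbers: $x/(e^x-1)=\sum B_nx^n/n!$. For $n\geq0$, $J_n(z,\tau) = \delta_{n,1} \frac{p}{p - 1} + B_n - n \sum_{k, r \geq 1} r^{n - 1} (p^k + (-1)^n p^{-k}) q^{k r}$ (meromorphically continued in $z$). *)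

theory Defs
  imports "HOL-Complex_Analysis.Complex_Analysis"
begin

definition theta1 :: "complex \<Rightarrow> complex \<Rightarrow> complex" where
  "theta1 z \<tau> =
     (let q = exp (2 * of_real pi * \<i> * \<tau>); p = exp (2 * of_real pi * \<i> * z)
      in - \<i> * exp (of_real pi * \<i> * \<tau> / 4)
           * (exp (of_real pi * \<i> * z) - exp (- (of_real pi * \<i> * z)))
           * (\<Prod>m. (1 - q ^ Suc m) * (1 - p * q ^ Suc m) * (1 - inverse p * q ^ Suc m)))"

definition Dz :: "(complex \<Rightarrow> complex) \<Rightarrow> complex \<Rightarrow> complex" where
  "Dz f z = deriv f z / (2 * of_real pi * \<i>)"

definition theta1_bullet :: "complex \<Rightarrow> complex \<Rightarrow> complex" where
  "theta1_bullet z \<tau> = Dz (\<lambda>w. theta1 w \<tau>) z"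

text \<open>The generating function is \<open>x / (e^x - 1)\<close>, so \<open>B_1 = -1/2\<close>.\<close>

definition bernoulli_num :: "nat \<Rightarrow> complex" where
  "bernoulli_num n = fact n * fps_nth (fps_X / (fps_exp 1 - 1)) n"

text \<open>The defining double series of \<open>J_n\<close>; it converges absolutely for
  \<open>\<bar>Im z\<bar> < Im \<tau>\<close>, that is for \<open>\<bar>q\<bar> < \<bar>p\<bar> < 1 / \<bar>q\<bar>\<close>.\<close>

definition J_series :: "nat \<Rightarrow> complex \<Rightarrow> complex \<Rightarrow> complex" where
  "J_series n z \<tau> =
     (let q = exp (2 * of_real pi * \<i> * \<tau>); p = exp (2 * of_real pi * \<i> * z)
      in (if n = 1 then p / (p - 1) else 0) + bernoulli_num n
         - of_nat n * (\<Sum>\<^sub>\<infinity>(k, r)\<in>{1..} \<times> {1..}.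
             of_nat r powi (int n - 1) * (p ^ k + (-1) ^ n * inverse p ^ k) * q ^ (k * r)))"

text \<open>The meromorphic continuation of the series in \<open>z\<close> to the whole plane. It is unique by
  the identity theorem, since a nicely meromorphic function takes its limit at each removable
  singularity and the value \<open>0\<close> at each pole. The points with \<open>p = 1\<close> are left out because
  there \<open>p / (p - 1)\<close> has a pole.\<close>

definition J :: "nat \<Rightarrow> complex \<Rightarrow> complex \<Rightarrow> complex" where
  "J n z \<tau> =
     (THE f. f nicely_meromorphic_on UNIV \<and>
        (\<forall>w. \<bar>Im w\<bar> < Im \<tau> \<and> exp (2 * of_real pi * \<i> * w) \<noteq> 1 \<longrightarrow> f w = J_series n w \<tau>)) z"

text \<open>\<open>exp (x \<partial>_z) f\<close> as a formal power series in \<open>x\<close>, with coefficients evaluated at \<open>z\<close>.\<close>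

definition exp_xDz :: "(complex \<Rightarrow> complex) \<Rightarrow> complex \<Rightarrow> complex fps" where
  "exp_xDz f z = Abs_fps (\<lambda>k. (Dz ^^ k) f z / fact k)"

text \<open>The power series of \<open>x \<theta>_1\<^sup>\<bullet>(0,\<tau>) / \<theta>_1(x/(2\<pi>i),\<tau>)\<close> at \<open>x = 0\<close>, as a quotient of formal power
  series; numerator and denominator both have order \<open>1\<close>, so this is the genuine quotient.\<close>

definition theta1_prefactor :: "complex \<Rightarrow> complex fps" where
  "theta1_prefactor \<tau> =
     fps_X * fps_const (theta1_bullet 0 \<tau>)
       / fps_expansion (\<lambda>x. theta1 (x / (2 * of_real pi * \<i>)) \<tau>) 0"

end

theory Submission
  imports Defs
begin

text \<open>
  In the variables \<open>p = e\<^sup>2\<^sup>\<pi>\<^sup>i\<^sup>z\<close> and \<open>y = e\<^sup>x\<close>, the right-hand side is \<open>x\<close> times the Kronecker function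
  \<open>\<theta>\<^sub>1\<^sup>\<bullet>(0) \<theta>\<^sub>1(z + u) / (\<theta>\<^sub>1(z) \<theta>\<^sub>1(u))\<close> with \<open>u = x / (2\<pi>i)\<close>. For \<open>\<bar>q\<bar> < \<bar>p\<bar>, \<bar>y\<bar> < 1 / \<bar>q\<bar>\<close> it
  equals \<open>p/(p-1) + 1/(y-1) - \<Sum>\<^sub>k\<^sub>,\<^sub>r (p\<^sup>k y\<^sup>r - p\<^sup>-\<^sup>k y\<^sup>-\<^sup>r) q\<^sup>k\<^sup>r\<close>: the difference \<open>D\<close> of the two sides
  has a removable singularity at \<open>y = 1\<close> and satisfies \<open>D(qy) = D(y)/p\<close>. With \<open>\<bar>q\<bar>\<^sup>s = \<bar>p\<bar>\<close>, the function
  \<open>\<bar>y\<bar>\<^sup>s \<bar>D(y)\<bar>\<close> is invariant under \<open>y \<mapsto> qy\<close> and so attains its maximum, which forces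
  \<open>D(y) = c y\<^sup>-\<^sup>s\<close> and then \<open>D = 0\<close>. Expanding \<open>y\<^sup>r = e\<^sup>r\<^sup>x\<close> and exchanging the sums gives the defining
  series of \<open>J\<^sub>n\<close>. The coefficients of the right-hand side are meromorphic in \<open>z\<close> on the whole plane,
  with poles only at lattice points, so they are the continuation of that series.
\<close>

section \<open>The theta function as a product\<close>

definition qpoch :: "complex \<Rightarrow> complex \<Rightarrow> complex" where
  "qpoch a q = (\<Prod>n. 1 - a * q ^ n)"

text \<open>This is \<open>theta1\<close> in the variable \<open>y = p\<close> without the constant
  \<open>qpoch q q\<close> and without \<open>p^(1/2)\<close>, so that it is single-valued in
  \<open>y\<close>.\<close>

definition qtheta :: "complex \<Rightarrow> complex \<Rightarrow> complex" where
  "qtheta q y = qpoch y q * qpoch (q / y) q"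

lemma convergent_prod_qpoch:
  fixes a q :: complex
  assumes "norm q < 1"
  shows "convergent_prod (\<lambda>n. 1 - a * q ^ n)"
proof (rule abs_convergent_prod_imp_convergent_prod, rule summable_imp_abs_convergent_prod)
  have "summable (\<lambda>n. norm a * norm q ^ n)"
    using assms by (intro summable_mult summable_geometric) auto
  thus "summable (\<lambda>n. norm (1 - a * q ^ n - 1))"
    by (simp add: norm_mult norm_power)
qed

lemma has_prod_qpoch:
  assumes "norm q < 1"
  shows "(\<lambda>n. 1 - a * q ^ n) has_prod qpoch a q"
  unfolding qpoch_def by (intro convergent_prod_has_prod convergent_prod_qpoch assms)

lemma qpoch_eq_0_iff:
  assumes "norm q < 1"
  shows "qpoch a q = 0 \<longleftrightarrow> (\<exists>n. a * q ^ n = 1)"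
  using has_prod_eq_0_iff[OF has_prod_qpoch[OF assms, of a]] by (auto simp: image_iff)

lemma qpoch_self_nonzero:
  assumes "norm q < 1"
  shows "qpoch q q \<noteq> 0"
proof
  assume "qpoch q q = 0"
  then obtain n where n: "q * q ^ n = 1"
    using qpoch_eq_0_iff[OF assms] by auto
  have "norm (q * q ^ n) \<le> norm q"
    unfolding norm_mult norm_power using assms by (intro mult_right_le_one_le power_le_one) auto
  thus False
    using assms n by simp
qed

lemma qpoch_rec:
  assumes "norm q < 1"
  shows "qpoch a q = (1 - a) * qpoch (a * q) q"
\<comment> \<open>For \<open>a = 1\<close> the head factor is zero and both sides vanish; otherwise
  it can be divided out.\<close>
proof (cases "a = 1")
  case True
  thus ?thesis
    using qpoch_eq_0_iff[OF assms, of a] by (auto intro: exI[of _ 0])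
next
  case False
  thus ?thesis
    using prodinf_split_head[OF convergent_prod_qpoch[OF assms, of a]]
    by (simp add: qpoch_def mult_ac)
qed

text \<open>The partial products converge uniformly on every closed unit disc: there
  \<open>norm a \<le> norm z + 1\<close>, which gives a geometric majorant.\<close>

lemma holomorphic_qpoch_UNIV:
  assumes q: "norm q < 1"
  shows "(\<lambda>a. qpoch a q) holomorphic_on UNIV"
proof (rule holomorphic_uniform_sequence)
  fix z :: complex
  have "uniformly_convergent_on (cball z 1) (\<lambda>N a. \<Prod>n<N. 1 - a * q ^ n)"
  proof (rule uniformly_convergent_on_prod')
    show "uniformly_convergent_on (cball z 1) (\<lambda>N a. \<Sum>n<N. norm (1 - a * q ^ n - 1))"
    proof (rule Weierstrass_m_test')
      show "summable (\<lambda>n. (norm z + 1) * norm q ^ n)"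
        using q by (intro summable_mult summable_geometric) auto
      fix n a assume "a \<in> cball z 1"
      hence "norm (a - z) \<le> 1"
        by (simp add: dist_norm norm_minus_commute)
      hence "norm a \<le> norm z + 1"
        using norm_triangle_sub[of a z] by linarith
      thus "norm (norm (1 - a * q ^ n - 1)) \<le> (norm z + 1) * norm q ^ n"
        by (simp add: norm_mult norm_power mult_right_mono)
    qed
  qed (auto intro!: continuous_intros)
  then obtain g where g: "uniform_limit (cball z 1) (\<lambda>N a. \<Prod>n<N. 1 - a * q ^ n) g sequentially"
    by (auto simp: uniformly_convergent_on_def)
  have "g a = qpoch a q" if "a \<in> cball z 1" for a
    using tendsto_uniform_limitI[OF g that] has_prod_imp_tendsto'[OF has_prod_qpoch[OF q, of a]]
    by (rule LIMSEQ_unique)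
  hence "uniform_limit (cball z 1) (\<lambda>N a. \<Prod>n<N. 1 - a * q ^ n) (\<lambda>a. qpoch a q) sequentially"
    using g by (subst uniform_limit_cong'[of _ _ _ _ g]) auto
  thus "\<exists>d>0. cball z d \<subseteq> UNIV \<and>
          uniform_limit (cball z d) (\<lambda>N a. \<Prod>n<N. 1 - a * q ^ n) (\<lambda>a. qpoch a q) sequentially"
    by (intro exI[of _ 1]) auto
qed (auto intro!: holomorphic_intros)

lemma holomorphic_on_qpoch [holomorphic_intros]:
  assumes "f holomorphic_on A" "norm q < 1"
  shows "(\<lambda>z. qpoch (f z) q) holomorphic_on A"
  using holomorphic_on_compose_gen[OF assms(1) holomorphic_qpoch_UNIV[OF assms(2)]]
  by (simp add: o_def)

section \<open>Zeros and quasi-periodicity of the theta product\<close>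

lemma qtheta_eq_0D:
  assumes "norm q < 1" "qtheta q y = 0"
  shows "\<exists>n::int. y = q powi n"
proof -
  consider n where "y * q ^ n = 1" | n where "(q / y) * q ^ n = 1"
    using assms by (auto simp: qtheta_def qpoch_eq_0_iff)
  thus ?thesis
  proof cases
    case 1
    hence "y = inverse (q ^ n)"
      by (metis inverse_unique mult.commute)
    hence "y = q powi (- int n)"
      by (simp add: power_int_minus)
    thus ?thesis by blast
  next
    case 2
    hence "y = q powi int (Suc n)"
      by (auto simp: field_simps power_int_add)
    thus ?thesis by blast
  qed
qed

text \<open>Every factor except \<open>1 - y\<close> has the form \<open>1 - t\<close> with
  \<open>norm t\<close> at most \<open>norm (y * q)\<close> or \<open>norm (q / y)\<close>, both
  less than 1.\<close>

lemma qtheta_eq_0_annulus: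
  assumes q: "norm q < 1" and y: "norm q < norm y" "norm y * norm q < 1" "qtheta q y = 0"
  shows "y = 1"
proof -
  consider n where "y * q ^ n = 1" | n where "(q / y) * q ^ n = 1"
    using assms by (auto simp: qtheta_def qpoch_eq_0_iff)
  thus ?thesis
  proof cases
    case (1 n)
    show ?thesis
    proof (cases n)
      case (Suc m)
      have "norm (y * q ^ n) = (norm y * norm q) * norm q ^ m"
        by (simp add: Suc norm_mult norm_power)
      also have "\<dots> \<le> norm y * norm q"
        using q y by (intro mult_right_le_one_le power_le_one) auto
      finally show ?thesis
        using 1 y by simp
    qed (use 1 in auto)
  next
    case (2 n)
    have "norm (q / y * q ^ n) \<le> norm (q / y)"
      unfolding norm_mult norm_power using q by (intro mult_right_le_one_le power_le_one) auto
    also have "\<dots> < 1"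
      using y(1) order_le_less_trans[OF norm_ge_zero y(1)] by (simp add: norm_divide)
    finally show ?thesis
      using 2 by simp
  qed
qed

text \<open>The shift removes the factor \<open>1 - y\<close> from the first product and adds
  \<open>1 - 1 / y = - (1 - y) / y\<close> to the second.\<close>

lemma qtheta_mult_q:
  assumes "norm q < 1" "q \<noteq> 0" "y \<noteq> 0"
  shows "qtheta q (q * y) = - qtheta q y / y"
proof -
  have "qpoch y q = (1 - y) * qpoch (q * y) q"
    using qpoch_rec[OF assms(1), of y] by (simp add: mult_ac)
  moreover have "qpoch (1 / y) q = (1 - 1 / y) * qpoch (q / y) q"
    using qpoch_rec[OF assms(1), of "1 / y"] by (simp add: mult_ac)
  moreover have "qtheta q (q * y) = qpoch (q * y) q * qpoch (1 / y) q"
    using assms by (simp add: qtheta_def)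
  moreover have "1 - 1 / y = - (1 - y) / y"
    using assms by (simp add: field_simps)
  ultimately have "qtheta q (q * y) = qpoch (q * y) q * (- (1 - y) / y * qpoch (q / y) q)"
    by metis
  also have "\<dots> = - ((1 - y) * qpoch (q * y) q * qpoch (q / y) q) / y"
    using assms(3) by (simp add: field_simps)
  also have "(1 - y) * qpoch (q * y) q * qpoch (q / y) q = qtheta q y"
    using \<open>qpoch y q = _\<close> by (simp add: qtheta_def)
  finally show ?thesis .
qed

lemma holomorphic_on_qtheta [holomorphic_intros]:
  assumes "f holomorphic_on A" "norm q < 1" "\<And>z. z \<in> A \<Longrightarrow> f z \<noteq> 0"
  shows "(\<lambda>z. qtheta q (f z)) holomorphic_on A"
  unfolding qtheta_def using assms by (auto intro!: holomorphic_intros)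

text \<open>The prefactor is \<open>p^(1/2) - p^(-1/2) = - p^(-1/2) * (1 - p)\<close>, and
  \<open>1 - p\<close> is the factor with exponent 0 that turns \<open>qpoch (p * q) q\<close> into
  \<open>qpoch p q\<close>.\<close>

lemma theta1_conv_qtheta:
  fixes \<tau> z :: complex
  assumes "Im \<tau> > 0"
  defines "q \<equiv> exp (2 * of_real pi * \<i> * \<tau>)"
  shows "theta1 z \<tau> = \<i> * exp (of_real pi * \<i> * \<tau> / 4) * exp (- (of_real pi * \<i> * z)) *
           qpoch q q * qtheta q (exp (2 * of_real pi * \<i> * z))"
proof -
  define p where "p = exp (2 * of_real pi * \<i> * z)"
  define e where "e = exp (of_real pi * \<i> * z)"
  have q: "norm q < 1"
    using assms by (auto simp: q_def norm_exp_eq_Re)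
  have "2 * of_real pi * \<i> * z = of_real pi * \<i> * z + of_real pi * \<i> * z"
    by simp
  hence p: "p = e * e"
    unfolding p_def e_def exp_add[symmetric] by (rule arg_cong)
  have [simp]: "e \<noteq> 0"
    by (simp add: e_def)
  have "(\<lambda>n. (1 - q * q ^ n) * (1 - (p * q) * q ^ n) * (1 - (q / p) * q ^ n)) has_prod
          (qpoch q q * qpoch (p * q) q * qpoch (q / p) q)"
    by (intro has_prod_mult has_prod_qpoch q)
  hence prod: "(\<Prod>m. (1 - q ^ Suc m) * (1 - p * q ^ Suc m) * (1 - inverse p * q ^ Suc m)) =
          qpoch q q * qpoch (p * q) q * qpoch (q / p) q"
    by (simp add: has_prod_iff divide_inverse mult_ac)
  have sin_e: "e - 1 / e = - (1 / e * (1 - p))"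
    by (simp add: p field_simps)
  have inv_e: "exp (- (of_real pi * \<i> * z)) = 1 / e"
    by (simp add: e_def exp_minus divide_inverse)
  have "theta1 z \<tau> = - \<i> * exp (of_real pi * \<i> * \<tau> / 4) * (e - 1 / e) *
          (qpoch q q * qpoch (p * q) q * qpoch (q / p) q)"
    unfolding theta1_def Let_def q_def[symmetric] p_def[symmetric] prod inv_e e_def[symmetric]
    by (rule refl)
  also have "\<dots> = \<i> * exp (of_real pi * \<i> * \<tau> / 4) * (1 / e) * qpoch q q *
                    (((1 - p) * qpoch (p * q) q) * qpoch (q / p) q)"
    unfolding sin_e by simp
  also have "(1 - p) * qpoch (p * q) q = qpoch p q"
    using qpoch_rec[OF q, of p] by simp
  finally show ?thesis
    unfolding qtheta_def p_def[symmetric] inv_e by (simp add: mult.assoc)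
qed

section \<open>Multiplicative functions on an annulus\<close>

text \<open>A Liouville argument on the torus obtained by identifying \<open>y\<close> with
  \<open>q * y\<close>. The multiplier \<open>p\<close> lies in the annulus and differs from 1, so
  it is not a power of \<open>q\<close>, which leaves only the zero function. The rule for
  \<open>D\<close> is assumed only where both \<open>y\<close> and \<open>q * y\<close> lie in the
  annulus.\<close>

lemma multiplicative_annulus_eq_0:
  fixes p q :: complex
  assumes q: "q \<noteq> 0" "norm q < 1"
    and p: "norm q < norm p" "norm p * norm q < 1" "p \<noteq> 1"
    and holo: "D holomorphic_on {y. norm q < norm y \<and> norm y * norm q < 1}"
    and mult: "\<And>y. 1 < norm y \<Longrightarrow> norm y * norm q < 1 \<Longrightarrow> D (q * y) = D y / p"
    and y: "norm q < norm y" "norm y * norm q < 1"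
  shows "D y = 0"
proof -
  define r where "r = norm q"
  \<comment> \<open>The exponent with \<open>r powr s = norm p\<close>; it makes \<open>g\<close>
    invariant under \<open>y \<mapsto> q * y\<close>.\<close>
  define s where "s = ln (norm p) / ln r"
  define W where "W = {y::complex. r < norm y \<and> norm y * r < 1}"
  define g where "g = (\<lambda>y. norm (D y) * norm y powr s)"
  \<comment> \<open>A compact fundamental domain: the ratio of its outer to its inner radius is
    \<open>1 / r\<close>.\<close>
  define K where "K = {y::complex. sqrt r \<le> norm y \<and> norm y \<le> 1 / sqrt r}"
  have r: "0 < r" "r < 1"
    using q by (auto simp: r_def)
  have p0: "norm p > 0"
    using p r by (auto simp: r_def intro: order_le_less_trans[OF norm_ge_zero])
  have lnr: "ln r < 0"
    using r by simp
  have sqrt_r: "0 < sqrt r" "sqrt r < 1" "r < sqrt r" "sqrt r * sqrt r = r"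
    using r by (auto simp: real_less_rsqrt power2_eq_square)
  have powr_s: "r powr s = norm p"
    using p0 r lnr by (simp add: s_def powr_def)
  have "ln (norm p) < - ln r"
    using p(2) r p0 by (metis add_less_cancel_right ln_mult ln_less_zero_iff mult_pos_pos
        add.left_inverse r_def less_numeral_extra(3))
  moreover have "ln r < ln (norm p)"
    using p(1) r p0 by (simp add: r_def)
  \<comment> \<open>Once \<open>s\<close> is known to be an integer, this bound forces
    \<open>s = 0\<close>.\<close>
  ultimately have s: "\<bar>s\<bar> < 1"
    using lnr by (simp add: s_def abs_less_iff field_simps)
  have holW: "D holomorphic_on W"
    using holo by (simp add: W_def r_def)
  have contW: "continuous_on W g"
    using r by (auto simp: g_def W_def intro!: continuous_intros
                  holomorphic_on_imp_continuous_on[OF holW, unfolded W_def])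
  have g_mult: "g (q * y) = g y" if "1 < norm y" "norm y * r < 1" for y
    using mult[of y] that p0 powr_s r
    by (simp add: g_def r_def norm_mult norm_divide powr_mult)
  have "compact K"
  proof -
    have "K = cball 0 (1 / sqrt r) - ball 0 (sqrt r)"
      by (auto simp: K_def)
    thus ?thesis
      by (simp add: compact_diff)
  qed
  moreover have "1 \<in> K"
    using sqrt_r by (auto simp: K_def field_simps)
  moreover have KW: "K \<subseteq> W"
  proof
    fix y assume y: "y \<in> K"
    have "norm y * r \<le> 1 / sqrt r * r"
      using y r by (intro mult_right_mono) (auto simp: K_def)
    also have "\<dots> = sqrt r"
      using sqrt_r by (simp add: field_simps)
    finally have "norm y * r < 1"
      using sqrt_r(2) by linarith
    moreover have "r < norm y"
      using y sqrt_r(3) unfolding K_def by simp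
    ultimately show "y \<in> W"
      by (simp add: W_def)
  qed
  ultimately obtain y0 where y0: "y0 \<in> K" "\<And>y. y \<in> K \<Longrightarrow> g y \<le> g y0"
    using continuous_attains_sup[of K g] continuous_on_subset[OF contW] by blast
  \<comment> \<open>The annulus \<open>W\<close> spans two periods, so a point outside
    \<open>K\<close> enters \<open>K\<close> after one multiplication or division by
    \<open>q\<close>, with \<open>g\<close> unchanged.\<close>
  have max: "g y \<le> g y0" if "y \<in> W" for y
  proof -
    consider "y \<in> K" | "norm y < sqrt r" | "norm y > 1 / sqrt r"
      by (force simp: K_def)
    thus ?thesis
    proof cases
      case 2
      have "norm y < 1"
        using 2 sqrt_r(2) by linarith
      hence "norm (y / q) > 1" "norm (y / q) * r < 1"
        using that r by (auto simp: W_def norm_divide r_def[symmetric])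
      hence "g y = g (y / q)"
        using g_mult[of "y / q"] q by simp
      moreover have "norm y / r \<le> sqrt r / r"
        using 2 r by (intro divide_right_mono) auto
      moreover have "sqrt r / r = 1 / sqrt r"
        using sqrt_r by (simp add: field_simps)
      moreover have "norm (y / q) = norm y / r"
        by (simp add: norm_divide r_def)
      ultimately show ?thesis
        using y0(2)[of "y / q"] sqrt_r(2) \<open>norm (y / q) > 1\<close> unfolding K_def by force
    next
      case 3
      have "1 < 1 / sqrt r"
        using sqrt_r by simp
      hence "norm y > 1"
        using 3 by simp
      moreover have "norm y * r < 1"
        using that by (simp add: W_def)
      ultimately have "g y = g (q * y)"
        using g_mult[of y] by simp
      moreover have "1 / sqrt r * r \<le> norm y * r"
        using 3 r by (intro mult_right_mono) auto
      moreover have "1 / sqrt r * r = sqrt r"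
        using sqrt_r by (simp add: field_simps)
      moreover have "1 \<le> 1 / sqrt r"
        using sqrt_r by simp
      ultimately show ?thesis
        using y0(2)[of "q * y"] that by (simp add: K_def W_def norm_mult r_def[symmetric] mult_ac)
    qed (use y0 in auto)
  qed
  define V where "V = {u. Re u > ln r} \<inter> {u. Re u < - ln r}"
  define E where "E = (\<lambda>u. exp (of_real s * u) * D (exp u))"
  have V_iff: "u \<in> V \<longleftrightarrow> exp u \<in> W" for u
  proof -
    have "r < exp (Re u) \<longleftrightarrow> ln r < Re u"
      using r by (metis exp_less_cancel_iff exp_ln)
    moreover have "exp (Re u) * r < 1 \<longleftrightarrow> Re u < - ln r"
    proof -
      have "exp (Re u) * r = exp (Re u + ln r)"
        using r by (simp add: exp_add)
      thus ?thesis by auto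
    qed
    ultimately show ?thesis
      by (auto simp: V_def W_def norm_exp_eq_Re)
  qed
  have normE: "norm (E u) = g (exp u)" for u
    by (simp add: E_def g_def norm_mult norm_exp_eq_Re powr_def mult_ac)
  \<comment> \<open>\<open>y powr s\<close> is not single-valued on the annulus, so the maximum principle is applied after
    the substitution \<open>y = exp u\<close>.\<close>
  have "open V"
    unfolding V_def by (intro open_Int open_halfspace_Re_gt open_halfspace_Re_lt)
  have "E constant_on V"
  proof (rule maximum_modulus_principle[of E V V "Ln y0"])
    show "E holomorphic_on V"
      unfolding E_def using V_iff
      by (intro holomorphic_intros holomorphic_on_compose_gen[OF _ holW, unfolded o_def]) auto
    show "connected V"
      unfolding V_def by (intro convex_connected convex_Int convex_halfspace_Re_gt convex_halfspace_Re_lt)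
    have "y0 \<noteq> 0"
      using y0 sqrt_r by (auto simp: K_def)
    thus "Ln y0 \<in> V"
      using y0 KW by (auto simp: V_iff)
    show "norm (E u) \<le> norm (E (Ln y0))" if "u \<in> V" for u
      using max[of "exp u"] that \<open>y0 \<noteq> 0\<close> by (simp add: V_iff normE)
  qed (use \<open>open V\<close> in auto)
  then obtain C where C: "\<And>u. u \<in> V \<Longrightarrow> exp (of_real s * u) * D (exp u) = C"
    by (auto simp: constant_on_def E_def)
  have "C = 0"
  proof (rule ccontr)
    assume "C \<noteq> 0"
    \<comment> \<open>The points \<open>0\<close> and \<open>2 * pi * \<i>\<close> of
      \<open>V\<close> have the same exponential, so one turn around the annulus gives
      \<open>exp (2 * pi * \<i> * s) = 1\<close>.\<close>
    have "exp (of_real s * (2 * of_real pi * \<i>)) * D (exp (2 * of_real pi * \<i>)) = D 1"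
      using C[of 0] C[of "2 * of_real pi * \<i>"] lnr by (auto simp: V_def)
    moreover have "D 1 = C"
      using C[of 0] lnr by (auto simp: V_def)
    ultimately have "exp (of_real s * (2 * of_real pi * \<i>)) = 1"
      using \<open>C \<noteq> 0\<close> by simp
    then obtain n :: int where "s * (2 * pi) = of_int (2 * n) * pi"
      by (auto simp: exp_eq_1)
    hence "s = of_int n"
      by simp
    with s have "s = 0"
      by simp
    have const: "D y = C" if "y \<in> W" for y
    proof -
      have "y \<noteq> 0"
        using that r by (auto simp: W_def)
      thus ?thesis
        using C[of "Ln y"] that V_iff[of "Ln y"] \<open>s = 0\<close> by simp
    qed
    \<comment> \<open>Both \<open>t\<close> and \<open>q * t\<close> lie in \<open>W\<close>, so a
      constant \<open>D\<close> would satisfy \<open>C = C / p\<close>, contrary to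
      \<open>p \<noteq> 1\<close>.\<close>
    obtain t where t: "1 < t" "t < 1 / r"
      using dense[of 1 "1 / r"] r by auto
    hence t': "t * r < 1"
      using r by (simp add: field_simps)
    have "r * 1 < r * t"
      using t r by (intro mult_strict_left_mono) auto
    moreover have "r * r < 1" "r * r * t < 1"
    proof -
      show "r * r < 1" using mult_strict_mono[of r 1 r 1] r by simp
      have "r * (t * r) < 1 * 1" using r t t' by (intro mult_strict_mono) auto
      thus "r * r * t < 1" by (simp add: mult_ac)
    qed
    ultimately have "D (q * of_real t) = C" "D (of_real t) = C"
      using t t' r by (auto intro!: const simp: W_def norm_mult r_def[symmetric] mult_ac)
    moreover have "D (q * of_real t) = D (of_real t) / p"
      using t t' by (intro mult) (auto simp: r_def)
    ultimately have "C * p = C"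
      using p0 by (auto simp: field_simps)
    thus False
      using \<open>C \<noteq> 0\<close> p by simp
  qed
  have "y \<noteq> 0"
    using y r by (auto simp: r_def)
  moreover have "y \<in> W"
    using y by (simp add: W_def r_def)
  ultimately show "D y = 0"
    using C[of "Ln y"] \<open>C = 0\<close> V_iff[of "Ln y"] by simp
qed

section \<open>The Kronecker function as a Lambert series\<close>

text \<open>This is the double series of \<open>p^k * y^r * q^(k * r)\<close> over
  \<open>k, r \<ge> 1\<close> with the geometric sum over \<open>r\<close> carried out.\<close>

definition lambert :: "complex \<Rightarrow> complex \<Rightarrow> complex \<Rightarrow> complex" where
  "lambert q p y = (\<Sum>k. p ^ Suc k * (y * q ^ Suc k) / (1 - y * q ^ Suc k))"

text \<open>The constant \<open>c\<close> stands in for \<open>norm (y * q)\<close> so that the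
  bound can be made uniform on a disc of values \<open>y\<close>.\<close>

lemma norm_lambert_term_le:
  fixes p q y :: complex
  assumes "norm q < 1" "norm (y * q) \<le> c" "c < 1"
  shows "norm (p ^ Suc k * (y * q ^ Suc k) / (1 - y * q ^ Suc k)) \<le> norm (p * q) ^ Suc k * (norm y / (1 - c))"
proof -
  have "norm (y * q ^ Suc k) = norm (y * q) * norm q ^ k"
    by (simp add: norm_mult norm_power mult_ac)
  also have "\<dots> \<le> norm (y * q)"
    using assms by (intro mult_right_le_one_le power_le_one) auto
  finally have "norm (y * q ^ Suc k) \<le> c"
    using assms by simp
  moreover have "1 - norm (y * q ^ Suc k) \<le> norm (1 - y * q ^ Suc k)"
    using norm_triangle_ineq2[of 1 "y * q ^ Suc k"] by simp
  ultimately have "1 - c \<le> norm (1 - y * q ^ Suc k)"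
    by linarith
  hence "norm (p ^ Suc k * (y * q ^ Suc k)) / norm (1 - y * q ^ Suc k) \<le>
           norm (p ^ Suc k * (y * q ^ Suc k)) / (1 - c)"
    using assms by (intro divide_left_mono mult_pos_pos) auto
  thus ?thesis
    by (simp add: norm_mult norm_divide norm_power power_mult_distrib mult_ac)
qed

lemma summable_lambert:
  fixes p q y :: complex
  assumes "norm q < 1" "norm (p * q) < 1" "norm (y * q) < 1"
  shows "summable (\<lambda>k. p ^ Suc k * (y * q ^ Suc k) / (1 - y * q ^ Suc k))"
proof (rule summable_comparison_test')
  show "summable (\<lambda>k. norm (p * q) ^ Suc k * (norm y / (1 - norm (y * q))))"
    using assms by (intro summable_mult2 summable_Suc_iff[THEN iffD2] summable_geometric) auto
  show "norm (p ^ Suc k * (y * q ^ Suc k) / (1 - y * q ^ Suc k))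
          \<le> norm (p * q) ^ Suc k * (norm y / (1 - norm (y * q)))" for k
    using assms by (intro norm_lambert_term_le) auto
qed

text \<open>Replacing \<open>y\<close> by \<open>q * y\<close> shifts the summation index by one;
  the power of \<open>p\<close> lags behind, hence the division by \<open>p\<close> and the missing
  first term.\<close>

lemma lambert_mult_q:
  assumes "norm q < 1" "norm (p * q) < 1" "norm (y * q) < 1" "p \<noteq> 0"
  shows "lambert q p (q * y) = (lambert q p y - p * (y * q) / (1 - y * q)) / p"
proof -
  define a where "a = (\<lambda>k. p ^ Suc k * (y * q ^ Suc k) / (1 - y * q ^ Suc k))"
  have a: "summable a"
    unfolding a_def by (intro summable_lambert assms)
  have "lambert q p (q * y) = (\<Sum>k. a (Suc k) / p)"
    using assms(4) by (simp add: lambert_def a_def mult_ac)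
  also have "\<dots> = (\<Sum>k. a (Suc k)) / p"
    using a by (intro suminf_divide) (simp add: summable_Suc_iff)
  also have "(\<Sum>k. a (Suc k)) = suminf a - a 0"
    using suminf_split_head[OF a] by simp
  finally show ?thesis
    by (simp add: a_def lambert_def)
qed

lemma holomorphic_lambert:
  assumes q: "norm q < 1" and pq: "norm (p * q) < 1"
  shows "(\<lambda>y. lambert q p y) holomorphic_on {y. norm (y * q) < 1}"
proof (rule holomorphic_uniform_sequence)
  show "open {y. norm (y * q) < 1}"
    by (intro open_Collect_less continuous_intros)
  show "(\<lambda>y. \<Sum>k<n. p ^ Suc k * (y * q ^ Suc k) / (1 - y * q ^ Suc k)) holomorphic_on
          {y. norm (y * q) < 1}" for n
  proof (intro holomorphic_intros)
    fix k y assume y: "y \<in> {y. norm (y * q) < 1}"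
    have "norm (y * q ^ Suc k) = norm (y * q) * norm q ^ k"
      by (simp add: norm_mult norm_power mult_ac)
    also have "\<dots> \<le> norm (y * q)"
      using q by (intro mult_right_le_one_le power_le_one) auto
    finally show "1 - y * q ^ Suc k \<noteq> 0"
      using y by auto
  qed
next
  fix y0 assume "y0 \<in> {y. norm (y * q) < 1}"
  hence y0: "norm (y0 * q) < 1"
    by simp
  define c where "c = (norm (y0 * q) + 1) / 2"
  have c: "norm (y0 * q) < c" "c < 1"
    using y0 by (auto simp: c_def)
  \<comment> \<open>With this radius
    \<open>norm (y * q) \<le> norm (y0 * q) + d * norm q \<le> c\<close> on the disc, because
    \<open>norm q < 1\<close>.\<close>
  define d where "d = c - norm (y0 * q)"
  have d: "d > 0"
    using c by (simp add: d_def)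
  have bound: "norm (y * q) \<le> c" "norm y \<le> norm y0 + d" if "y \<in> cball y0 d" for y
  proof -
    have dist: "norm (y - y0) \<le> d"
      using that by (simp add: dist_norm norm_minus_commute)
    have "norm ((y - y0) * q) \<le> d * 1"
      unfolding norm_mult using dist q d by (intro mult_mono) auto
    thus "norm (y * q) \<le> c"
      using norm_triangle_sub[of "y * q" "y0 * q"] by (simp add: d_def algebra_simps)
    show "norm y \<le> norm y0 + d"
      using dist norm_triangle_sub[of y y0] by linarith
  qed
  have "uniform_limit (cball y0 d) (\<lambda>n y. \<Sum>k<n. p ^ Suc k * (y * q ^ Suc k) / (1 - y * q ^ Suc k))
          (lambert q p) sequentially"
    unfolding lambert_def
  proof (rule Weierstrass_m_test)
    show "summable (\<lambda>k. norm (p * q) ^ Suc k * ((norm y0 + d) / (1 - c)))"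
      using pq by (intro summable_mult2 summable_Suc_iff[THEN iffD2] summable_geometric) auto
    fix k y assume y: "y \<in> cball y0 d"
    have "norm (p ^ Suc k * (y * q ^ Suc k) / (1 - y * q ^ Suc k)) \<le>
            norm (p * q) ^ Suc k * (norm y / (1 - c))"
      using q c bound[OF y] by (intro norm_lambert_term_le) auto
    also have "\<dots> \<le> norm (p * q) ^ Suc k * ((norm y0 + d) / (1 - c))"
      using bound[OF y] c by (intro mult_left_mono divide_right_mono) auto
    finally show "norm (p ^ Suc k * (y * q ^ Suc k) / (1 - y * q ^ Suc k)) \<le>
                    norm (p * q) ^ Suc k * ((norm y0 + d) / (1 - c))" .
  qed
  moreover have "cball y0 d \<subseteq> {y. norm (y * q) < 1}"
    using bound(1) c by force
  ultimately show "\<exists>d>0. cball y0 d \<subseteq> {y. norm (y * q) < 1} \<and>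
      uniform_limit (cball y0 d) (\<lambda>n y. \<Sum>k<n. p ^ Suc k * (y * q ^ Suc k) / (1 - y * q ^ Suc k))
        (lambert q p) sequentially"
    using d by blast
qed

text \<open>The left-hand side is the Kronecker function after its exponential factors have
  cancelled; the minus sign is that of \<open>theta1_bullet 0 \<tau>\<close>.\<close>

lemma kronecker_qtheta:
  fixes p q y :: complex
  assumes q: "q \<noteq> 0" "norm q < 1"
    and p: "norm q < norm p" "norm p * norm q < 1" "p \<noteq> 1"
    and y: "norm q < norm y" "norm y * norm q < 1" "y \<noteq> 1"
  shows "- (qpoch q q ^ 2 * qtheta q (p * y) / (qtheta q p * qtheta q y)) =
           p / (p - 1) + 1 / (y - 1) - (lambert q p y - lambert q (1 / p) (1 / y))"
proof -
  define W where "W = {y::complex. norm q < norm y \<and> norm y * norm q < 1}"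
  \<comment> \<open>\<open>U\<close> is \<open>qtheta\<close> without its only zero in the annulus.
    The left-hand side equals \<open>M y / (y - 1)\<close>, and \<open>M 1 = 1\<close> matches the
    residue of \<open>1 / (y - 1)\<close>.\<close>
  define U where "U = (\<lambda>y. qpoch (y * q) q * qpoch (q / y) q)"
  define M where "M = (\<lambda>y. qpoch q q ^ 2 * qtheta q (p * y) / (qtheta q p * U y))"
  \<comment> \<open>\<open>E\<close> extends the left-hand side minus \<open>1 / (y - 1)\<close> holomorphically over \<open>y = 1\<close>.\<close>
  define E where "E = (\<lambda>y. if y = 1 then deriv M 1 else (M y - M 1) / (y - 1))"
  define D where "D = (\<lambda>y. E y - p / (p - 1) + (lambert q p y - lambert q (1 / p) (1 / y)))"
  have qtheta_U: "qtheta q y = (1 - y) * U y" for y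
    using qpoch_rec[OF q(2), of y] by (simp add: qtheta_def U_def)
  have qtheta_p: "qtheta q p \<noteq> 0"
    using qtheta_eq_0_annulus[OF q(2) p(1,2)] p by auto
  have p0: "p \<noteq> 0"
    using p q by auto
  have poch_q: "qpoch q q \<noteq> 0"
    by (rule qpoch_self_nonzero[OF q(2)])
  have "W = {y::complex. norm q < norm y} \<inter> {y. norm y * norm q < 1}"
    by (auto simp: W_def)
  hence "open W"
    by (auto intro!: open_Int open_Collect_less continuous_intros)
  have W_nz: "y \<noteq> 0" if "y \<in> W" for y
    using that q by (auto simp: W_def)
  have one_W: "1 \<in> W"
    using q by (auto simp: W_def)
  have U_nz: "U y \<noteq> 0" if "y \<in> W" for y
  proof (cases "y = 1")
    case True
    thus ?thesis using poch_q by (simp add: U_def)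
  next
    case False
    thus ?thesis
      using qtheta_eq_0_annulus[OF q(2), of y] that by (auto simp: qtheta_U W_def)
  qed
  have M1: "M 1 = 1"
    using qtheta_p poch_q by (simp add: M_def U_def power2_eq_square)
  have "M holomorphic_on W"
    unfolding M_def U_def using U_nz[unfolded U_def] W_nz p0 qtheta_p q
    by (auto intro!: holomorphic_intros)
  hence holE: "E holomorphic_on W"
    unfolding E_def using \<open>open W\<close> by (rule pole_lemma_open)
  have hol1: "(\<lambda>y. lambert q p y) holomorphic_on W"
    using p by (intro holomorphic_on_subset[OF holomorphic_lambert[OF q(2)]])
               (auto simp: W_def norm_mult)
  have inv_p: "norm (1 / p * q) < 1"
    using p order_le_less_trans[OF norm_ge_zero p(1)] by (simp add: norm_divide norm_mult)
  have hol2: "(\<lambda>y. lambert q (1 / p) (1 / y)) holomorphic_on W"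
  proof (rule holomorphic_on_compose_gen[OF _ holomorphic_lambert[OF q(2) inv_p], unfolded o_def])
    show "(\<lambda>y. 1 / y) holomorphic_on W"
      using W_nz by (auto intro!: holomorphic_intros)
    show "(\<lambda>y. 1 / y) ` W \<subseteq> {y. norm (y * q) < 1}"
    proof safe
      fix y assume "y \<in> W"
      hence "norm q < norm y" by (simp add: W_def)
      moreover from this have "norm y > 0" by (rule order_le_less_trans[OF norm_ge_zero])
      ultimately show "norm (1 / y * q) < 1"
        by (simp add: norm_divide norm_mult)
    qed
  qed
  have E_eq: "E y = - (qpoch q q ^ 2 * qtheta q (p * y) / (qtheta q p * qtheta q y)) - 1 / (y - 1)"
    if "y \<noteq> 1" for y
  proof -
    have "qtheta q p * U y * (y - 1) = - (qtheta q p * qtheta q y)"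
      by (simp add: qtheta_U algebra_simps)
    moreover have "E y = (M y - 1) / (y - 1)"
      using that by (simp add: E_def M1)
    ultimately show ?thesis
      by (simp add: M_def diff_divide_distrib)
  qed
  have "D holomorphic_on W"
    unfolding D_def using holE hol1 hol2 by (intro holomorphic_intros) auto
  \<comment> \<open>The condition \<open>1 < norm y\<close> places both \<open>y\<close> and
    \<open>q * y\<close> in \<open>W\<close> and keeps both away from 1, so the explicit formula for
    \<open>E\<close> applies at each.\<close>
  moreover have "D (q * y) = D y / p" if y: "1 < norm y" "norm y * norm q < 1" for y
  proof -
    have [simp]: "y \<noteq> 0" and y1: "y \<noteq> 1" and yq1: "q * y \<noteq> 1"
      using y by (auto simp flip: norm_mult simp: mult.commute)
    have "qtheta q (p * (q * y)) = - qtheta q (p * y) / (p * y)"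
      using qtheta_mult_q[OF q(2,1), of "p * y"] p0 by (simp add: mult_ac)
    moreover have "qtheta q (q * y) = - qtheta q y / y"
      using qtheta_mult_q[OF q(2,1), of y] by simp
    ultimately have "qtheta q (p * (q * y)) / (qtheta q p * qtheta q (q * y)) =
               qtheta q (p * y) / (qtheta q p * qtheta q y) / p"
      by simp
    hence "qpoch q q ^ 2 * qtheta q (p * (q * y)) / (qtheta q p * qtheta q (q * y)) =
               qpoch q q ^ 2 * qtheta q (p * y) / (qtheta q p * qtheta q y) / p"
      by (metis times_divide_eq_right)
    hence Eq: "E (q * y) = (E y + 1 / (y - 1)) / p - 1 / (q * y - 1)"
      using E_eq[OF y1] E_eq[OF yq1] by simp
    have l1: "lambert q p (q * y) = (lambert q p y - p * (y * q) / (1 - y * q)) / p"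
      using q p y p0 by (intro lambert_mult_q) (auto simp: norm_mult)
    \<comment> \<open>The shift rule at the point \<open>1 / (q * y)\<close>, whose multiple by
      \<open>q\<close> is \<open>1 / y\<close>, is then solved for the value at
      \<open>1 / (q * y)\<close>.\<close>
    have "lambert q (1 / p) (q * (1 / (q * y))) =
            (lambert q (1 / p) (1 / (q * y)) - (1 / p) * (1 / (q * y) * q) / (1 - 1 / (q * y) * q)) / (1 / p)"
      using q p y p0 inv_p by (intro lambert_mult_q) (auto simp: norm_mult norm_divide)
    hence l2: "lambert q (1 / p) (1 / (q * y)) =
                 lambert q (1 / p) (1 / y) / p + (1 / p) * (1 / y) / (1 - 1 / y)"
      using q p0 by (simp add: field_simps)
    have "1 / y / (1 - 1 / y) = 1 / (y - 1)"
      using y1 by (simp add: field_simps)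
    hence l2: "lambert q (1 / p) (1 / (q * y)) =
                 lambert q (1 / p) (1 / y) / p + 1 / (p * (y - 1))"
      unfolding l2 by (metis times_divide_eq_right divide_divide_eq_left mult.right_neutral times_divide_eq_left mult_1)
    \<comment> \<open>The term \<open>1 / (p * (y - 1))\<close> from \<open>E\<close> cancels the
      one from the second Lambert series; what remains is an identity of rational functions.\<close>
    have "D (q * y) - D y / p = p / (p - 1) / p - p / (p - 1) - 1 / (q * y - 1) - y * q / (1 - y * q)"
      unfolding D_def Eq l1 l2 using p0 by (simp add: diff_divide_distrib add_divide_distrib)
    also have "p / (p - 1) / p - p / (p - 1) = -1"
      using p p0 by (simp add: field_simps)
    also have "-1 - 1 / (q * y - 1) - y * q / (1 - y * q) = 0"
      using yq1 by (simp add: divide_simps mult_ac) (simp add: algebra_simps)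
    finally show ?thesis by simp
  qed
  ultimately have "D y = 0"
    using multiplicative_annulus_eq_0[OF q p, of D y] y by (simp add: W_def)
  thus ?thesis
    using E_eq[OF y(3)] by (simp add: D_def algebra_simps)
qed

section \<open>Expansion of the Lambert series\<close>

text \<open>From \<open>(k - 1) * (r - 1) \<ge> 0\<close> follows
  \<open>k + r \<le> k * r + 1\<close>, so \<open>Q^(k * r)\<close> is at most
  \<open>Q^k * Q^r / Q\<close> and the series is dominated by a product of two geometric
  series.\<close>

lemma summable_double_geometric:
  fixes P Q Y :: real
  assumes "0 < Q" "Q < 1" "0 \<le> P" "P * Q < 1" "0 \<le> Y" "Y * Q < 1"
  shows "(\<lambda>(k, r). P ^ k * Q ^ (k * r) * Y ^ r) summable_on {1..} \<times> {1..}"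
proof (rule summable_on_comparison_test)
  have "(\<lambda>(k, r). (P * Q) ^ k * (Y * Q) ^ r) summable_on {1..} \<times> {1..}"
  proof (rule summable_on_SigmaI)
    fix k :: nat
    show "((\<lambda>r. case (k, r) of (k, r) \<Rightarrow> (P * Q) ^ k * (Y * Q) ^ r) has_sum
             (P * Q) ^ k * (Y * Q / (1 - Y * Q))) {1..}"
      unfolding prod.case using assms by (intro has_sum_cmult_right has_sum_geometric_from_1) auto
  next
    show "(\<lambda>k. (P * Q) ^ k * (Y * Q / (1 - Y * Q))) summable_on {1..}"
      using has_sum_geometric_from_1[of "P * Q"] assms
      by (intro summable_on_cmult_left) (auto simp: summable_on_def)
  qed (use assms in auto)
  hence "(\<lambda>z. (case z of (k, r) \<Rightarrow> (P * Q) ^ k * (Y * Q) ^ r) * (1 / Q)) summable_on {1..} \<times> {1..}"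
    by (rule summable_on_cmult_left)
  thus "(\<lambda>(k, r). (P * Q) ^ k * (Y * Q) ^ r / Q) summable_on {1..} \<times> {1..}"
    by (simp add: case_prod_unfold)
next
  fix z :: "nat \<times> nat" assume z: "z \<in> {1..} \<times> {1..}"
  obtain k r where [simp]: "z = (k, r)" and kr: "1 \<le> k" "1 \<le> r"
    using z by auto
  have "k + r \<le> Suc (k * r)"
    using kr by (cases k; cases r) auto
  hence "Q ^ Suc (k * r) \<le> Q ^ (k + r)"
    using assms by (intro power_decreasing) auto
  hence "Q ^ (k * r) \<le> Q ^ k * Q ^ r / Q"
    using assms by (simp add: field_simps power_add)
  hence "P ^ k * Y ^ r * Q ^ (k * r) \<le> P ^ k * Y ^ r * (Q ^ k * Q ^ r / Q)"
    using assms by (intro mult_left_mono) auto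
  thus "(case z of (k, r) \<Rightarrow> P ^ k * Q ^ (k * r) * Y ^ r) \<le> (case z of (k, r) \<Rightarrow> (P * Q) ^ k * (Y * Q) ^ r / Q)"
    by (simp add: power_mult_distrib mult_ac)
qed (use assms in auto)

text \<open>This is \<open>fact n\<close> times the coefficient of \<open>x^n\<close> in
  \<open>lambert q p (exp x)\<close>. The series of \<open>J_n\<close> involves index
  \<open>n - 1\<close>.\<close>

definition lambert_coeff :: "complex \<Rightarrow> complex \<Rightarrow> nat \<Rightarrow> complex" where
  "lambert_coeff q p n = (\<Sum>\<^sub>\<infinity>(k, r)\<in>{1..} \<times> {1..}. of_nat r ^ n * p ^ k * q ^ (k * r))"

text \<open>Absolute convergence after expanding \<open>exp (r * x)\<close> with
  \<open>norm x = X\<close>, which permits summation in either order. Summing over \<open>n\<close>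
  first leaves the double geometric series with \<open>Y = exp X\<close>.\<close>

lemma lambert_triple_summable:
  fixes p q :: complex
  assumes q: "q \<noteq> 0" "norm q < 1" and pq: "norm (p * q) < 1" and X: "0 \<le> X" "exp X * norm q < 1"
  shows "(\<lambda>((k, r), n). norm p ^ k * norm q ^ (k * r) * ((real r * X) ^ n / fact n))
            summable_on ({1..} \<times> {1..}) \<times> UNIV"
proof (rule summable_on_SigmaI)
  show "(\<lambda>(k, r). norm p ^ k * norm q ^ (k * r) * exp X ^ r) summable_on {1..} \<times> {1..}"
    using q pq X by (intro summable_double_geometric) (auto simp: norm_mult)
next
  fix z :: "nat \<times> nat"
  obtain k r where [simp]: "z = (k, r)" by (cases z)
  have "(\<lambda>n. (real r * X) ^ n / fact n) sums exp (real r * X)"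
    using exp_converges[of "real r * X"] by (simp add: field_simps)
  hence "((\<lambda>n. (real r * X) ^ n / fact n) has_sum exp (real r * X)) UNIV"
    using X by (intro sums_nonneg_imp_has_sum) auto
  thus "((\<lambda>n. (\<lambda>((k, r), n). norm p ^ k * norm q ^ (k * r) * ((real r * X) ^ n / fact n)) (z, n))
          has_sum (case z of (k, r) \<Rightarrow> norm p ^ k * norm q ^ (k * r) * exp X ^ r)) UNIV"
    using has_sum_cmult_right[of "\<lambda>n. (real r * X) ^ n / fact n" UNIV "exp (real r * X)"
            "norm p ^ k * norm q ^ (k * r)"]
    by (simp add: exp_of_nat_mult)
qed (use X in auto)

lemma exists_exp_mult_less_1:
  assumes "0 \<le> Q" "Q < (1::real)"
  shows "\<exists>X>0. exp X * Q < 1"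
proof -
  have "((\<lambda>X. exp X * Q) \<longlongrightarrow> exp 0 * Q) (at_right 0)"
    by (intro tendsto_intros)
  hence "eventually (\<lambda>X. exp X * Q < 1) (at_right 0)"
    using assms by (auto dest: order_tendstoD)
  moreover have "eventually (\<lambda>X::real. X > 0) (at_right 0)"
    by (simp add: eventually_at_right_less)
  ultimately have "eventually (\<lambda>X. X > 0 \<and> exp X * Q < 1) (at_right 0)"
    by eventually_elim auto
  from eventually_happens'[OF trivial_limit_at_right_real this] show ?thesis
    by blast
qed

text \<open>Fixing \<open>n\<close> in the convergent triple series for some small
  \<open>X > 0\<close> and dividing by \<open>X^n / fact n\<close> gives absolute
  convergence.\<close>

lemma lambert_coeff_has_sum:
  fixes p q :: complex
  assumes q: "q \<noteq> 0" "norm q < 1" and pq: "norm (p * q) < 1"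
  shows "((\<lambda>(k, r). of_nat r ^ n * p ^ k * q ^ (k * r)) has_sum lambert_coeff q p n) ({1..} \<times> {1..})"
proof -
  obtain X where X: "X > 0" "exp X * norm q < 1"
    using exists_exp_mult_less_1[of "norm q"] q by auto
  let ?f = "\<lambda>(z, n). case z of (k, r) \<Rightarrow> norm p ^ k * norm q ^ (k * r) * ((real r * X) ^ n / fact n)"
  have "?f summable_on ({1..} \<times> {1..}) \<times> UNIV"
    using lambert_triple_summable[OF assms, of X] X by (simp add: case_prod_unfold)
  hence "?f summable_on ({1..} \<times> {1..}) \<times> {n}"
    by (rule summable_on_subset) auto
  also have "({1..} \<times> {1..}) \<times> {n} = (\<lambda>z. (z, n)) ` ({1..} \<times> {1..})"
    by auto
  finally have "(\<lambda>(k, r). norm p ^ k * norm q ^ (k * r) * ((real r * X) ^ n / fact n)) summable_on {1..} \<times> {1..}"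
    by (subst (asm) summable_on_reindex) (auto simp: inj_on_def o_def case_prod_unfold)
  hence "(\<lambda>z. (case z of (k, r) \<Rightarrow> norm p ^ k * norm q ^ (k * r) * ((real r * X) ^ n / fact n)) * (fact n / X ^ n))
           summable_on {1..} \<times> {1..}"
    by (rule summable_on_cmult_left)
  hence "(\<lambda>z. norm (case z of (k, r) \<Rightarrow> of_nat r ^ n * p ^ k * q ^ (k * r))) summable_on {1..} \<times> {1..}"
    using X by (simp add: case_prod_unfold norm_mult norm_power power_mult_distrib mult_ac)
  hence "(\<lambda>(k, r). of_nat r ^ n * p ^ k * q ^ (k * r)) summable_on {1..} \<times> {1..}"
    by (rule abs_summable_summable)
  thus ?thesis
    unfolding lambert_coeff_def by (rule has_sum_infsum)
qed

lemma lambert_exp_sums: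
  fixes p q x :: complex
  assumes q: "q \<noteq> 0" "norm q < 1" and pq: "norm (p * q) < 1" and x: "exp (norm x) * norm q < 1"
  shows "(\<lambda>n. lambert_coeff q p n / fact n * x ^ n) sums lambert q p (exp x)"
proof -
  let ?A = "{1..} \<times> {1..} :: (nat \<times> nat) set"
  define H where "H = (\<lambda>(z, n). case z of (k, r) \<Rightarrow> p ^ k * q ^ (k * r) * ((of_nat r * x) ^ n / fact n))"
  have "(\<lambda>z. norm (H z)) summable_on ?A \<times> UNIV"
    using lambert_triple_summable[OF q pq norm_ge_zero x]
    by (simp add: H_def case_prod_unfold norm_mult norm_power norm_divide)
  hence "H summable_on ?A \<times> UNIV"
    by (rule abs_summable_summable)
  then obtain S where S: "(H has_sum S) (?A \<times> UNIV)"
    by (auto simp: summable_on_def)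
  \<comment> \<open>First order of summation: over \<open>n\<close>, then \<open>r\<close>, then
    \<open>k\<close>, which recovers the Lambert series.\<close>
  have "((\<lambda>(k, r). p ^ k * (exp x * q ^ k) ^ r) has_sum S) ?A"
  proof (rule has_sum_SigmaD[OF S])
    fix z :: "nat \<times> nat"
    obtain k r where [simp]: "z = (k, r)" by (cases z)
    have "(\<lambda>n. (of_nat r * x) ^ n / fact n) sums exp (of_nat r * x)"
      using exp_converges[of "of_nat r * x"] by (simp add: scaleR_conv_of_real field_simps)
    moreover have "summable (\<lambda>n. norm ((of_nat r * x) ^ n / fact n))"
      using summable_norm_exp[of "of_nat r * x"] by (simp add: norm_divide norm_mult field_simps)
    ultimately have "((\<lambda>n. (of_nat r * x) ^ n / fact n) has_sum exp (of_nat r * x)) UNIV"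
      by (intro norm_summable_imp_has_sum)
    hence "((\<lambda>n. p ^ k * q ^ (k * r) * ((of_nat r * x) ^ n / fact n)) has_sum
             (p ^ k * q ^ (k * r) * exp (of_nat r * x))) UNIV"
      by (rule has_sum_cmult_right)
    thus "((\<lambda>n. H (z, n)) has_sum (case z of (k, r) \<Rightarrow> p ^ k * (exp x * q ^ k) ^ r)) UNIV"
      by (simp add: H_def exp_of_nat_mult power_mult_distrib flip: power_mult) (simp add: mult_ac)
  qed
  hence "((\<lambda>k. p ^ k * (exp x * q ^ k / (1 - exp x * q ^ k))) has_sum S) {1..}"
  proof (rule has_sum_SigmaD)
    fix k :: nat assume "k \<in> {1..}"
    then obtain k' where k': "k = Suc k'"
      by (cases k) auto
    have "norm (exp x * q ^ k) = norm (exp x) * norm q * norm q ^ k'"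
      by (simp add: k' norm_mult norm_power mult_ac)
    also have "\<dots> \<le> norm (exp x) * norm q"
      using q by (intro mult_right_le_one_le power_le_one) auto
    also have "\<dots> \<le> exp (norm x) * norm q"
      by (intro mult_right_mono norm_exp) auto
    also have "\<dots> < 1"
      by (fact x)
    finally show "((\<lambda>r. case (k, r) of (k, r) \<Rightarrow> p ^ k * (exp x * q ^ k) ^ r) has_sum
                     p ^ k * (exp x * q ^ k / (1 - exp x * q ^ k))) {1..}"
      unfolding prod.case by (intro has_sum_cmult_right has_sum_geometric_from_1)
  qed
  also have "{1..} = range Suc"
    by (auto simp: image_iff dest!: Suc_le_D)
  finally have "((\<lambda>k. p ^ Suc k * (exp x * q ^ Suc k) / (1 - exp x * q ^ Suc k)) has_sum S) UNIV"
    by (subst (asm) has_sum_reindex) (auto simp: o_def)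
  hence S_eq: "S = lambert q p (exp x)"
    unfolding lambert_def by (intro sums_unique has_sum_imp_sums)
  \<comment> \<open>Second order of summation: over the pairs \<open>(k, r)\<close> first, which
    produces the power series in \<open>x\<close>.\<close>
  have "((\<lambda>(n, z). H (z, n)) has_sum S) (UNIV \<times> ?A)"
    using S by (subst (asm) has_sum_swap)
  hence "((\<lambda>n. lambert_coeff q p n * (x ^ n / fact n)) has_sum S) UNIV"
  proof (rule has_sum_SigmaD)
    fix n :: nat
    have "((\<lambda>z. (case z of (k, r) \<Rightarrow> of_nat r ^ n * p ^ k * q ^ (k * r)) * (x ^ n / fact n)) has_sum
             lambert_coeff q p n * (x ^ n / fact n)) ?A"
      by (intro has_sum_cmult_left lambert_coeff_has_sum q pq)
    thus "((\<lambda>z. case (n, z) of (n, z) \<Rightarrow> H (z, n)) has_sum lambert_coeff q p n * (x ^ n / fact n)) ?A"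
      by (simp add: H_def case_prod_unfold power_mult_distrib mult_ac)
  qed
  thus ?thesis
    using has_sum_imp_sums S_eq by fastforce
qed

text \<open>The values \<open>c = 1\<close> and \<open>c = -1\<close> serve \<open>y = exp x\<close>
  and \<open>1 / y\<close>; modulus 1 leaves the bound on \<open>norm x\<close> unchanged.\<close>

lemma lambert_exp_has_fps_expansion:
  fixes c p q :: complex
  assumes q: "q \<noteq> 0" "norm q < 1" and pq: "norm (p * q) < 1" and c: "norm c = 1"
  shows "(\<lambda>x. lambert q p (exp (c * x))) has_fps_expansion
            Abs_fps (\<lambda>n. c ^ n * lambert_coeff q p n / fact n)"
proof (rule has_fps_expansionI)
  obtain X where X: "X > 0" "exp X * norm q < 1"
    using exists_exp_mult_less_1[of "norm q"] q by auto
  have "eventually (\<lambda>x. norm x < X) (nhds (0::complex))"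
    using eventually_nhds_in_open[of "ball 0 X" "0::complex"] X by (simp add: dist_norm)
  thus "eventually (\<lambda>x. (\<lambda>n. fps_nth (Abs_fps (\<lambda>n. c ^ n * lambert_coeff q p n / fact n)) n * x ^ n)
                        sums lambert q p (exp (c * x))) (nhds 0)"
  proof eventually_elim
    case (elim x)
    have "exp (norm (c * x)) * norm q \<le> exp X * norm q"
      using elim c by (intro mult_right_mono) (auto simp: norm_mult)
    thus ?case
      using lambert_exp_sums[OF q pq, of "c * x"] X by (simp add: power_mult_distrib mult_ac)
  qed
qed

section \<open>The Jacobi theta function\<close>

lemma norm_exp_2pi_i_less_1:
  assumes "Im \<tau> > 0"
  shows "norm (exp (2 * of_real pi * \<i> * \<tau>)) < 1"
  using assms by (auto simp: norm_exp_eq_Re)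

lemma norm_nome_annulus:
  assumes "\<bar>Im z\<bar> < Im \<tau>"
  shows "norm (exp (2 * of_real pi * \<i> * \<tau>)) < norm (exp (2 * of_real pi * \<i> * z))"
    and "norm (exp (2 * of_real pi * \<i> * z)) * norm (exp (2 * of_real pi * \<i> * \<tau>)) < 1"
proof -
  show "norm (exp (2 * of_real pi * \<i> * \<tau>)) < norm (exp (2 * of_real pi * \<i> * z))"
    using assms by (simp add: norm_exp_eq_Re)
  have "0 < pi * (Im z + Im \<tau>)"
    using assms by (intro mult_pos_pos) auto
  thus "norm (exp (2 * of_real pi * \<i> * z)) * norm (exp (2 * of_real pi * \<i> * \<tau>)) < 1"
    by (simp add: norm_exp_eq_Re algebra_simps flip: exp_add)
qed

lemma holomorphic_on_theta1 [holomorphic_intros]: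
  assumes "Im \<tau> > 0" "f holomorphic_on A"
  shows "(\<lambda>z. theta1 (f z) \<tau>) holomorphic_on A"
  unfolding theta1_conv_qtheta[OF assms(1)]
  using assms(2) norm_exp_2pi_i_less_1[OF assms(1)] by (intro holomorphic_intros) auto

text \<open>The factors beside \<open>qtheta\<close> never vanish, so at a zero
  \<open>exp (2 * pi * \<i> * z)\<close> is a power of \<open>q\<close>; comparing exponents yields
  a lattice point.\<close>

lemma theta1_nonzero:
  assumes "Im \<tau> > 0" "z \<notin> {of_int a + of_int b * \<tau> | a b :: int. True}"
  shows "theta1 z \<tau> \<noteq> 0"
proof
  assume zero: "theta1 z \<tau> = 0"
  define q where "q = exp (2 * of_real pi * \<i> * \<tau>)"
  have q: "norm q < 1"
    using norm_exp_2pi_i_less_1[OF assms(1)] by (simp add: q_def)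
  have "qpoch q q \<noteq> 0"
    by (rule qpoch_self_nonzero[OF q])
  hence "qtheta q (exp (2 * of_real pi * \<i> * z)) = 0"
    using zero by (simp add: theta1_conv_qtheta[OF assms(1)] q_def)
  then obtain b :: int where "exp (2 * of_real pi * \<i> * z) = q powi b"
    using qtheta_eq_0D[OF q] by blast
  hence "exp (2 * of_real pi * \<i> * z) = exp (of_int b * (2 * of_real pi * \<i> * \<tau>))"
    by (simp add: q_def exp_power_int)
  then obtain a :: int where
      "2 * of_real pi * \<i> * z = of_int b * (2 * of_real pi * \<i> * \<tau>) + of_int (2 * a) * of_real pi * \<i>"
    by (auto simp: exp_eq)
  hence "2 * of_real pi * \<i> * z = 2 * of_real pi * \<i> * (of_int a + of_int b * \<tau>)"
    by (simp add: algebra_simps)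
  hence "z = of_int a + of_int b * \<tau>"
    by (subst (asm) mult_cancel_left) auto
  thus False
    using assms(2) by blast
qed

text \<open>A lattice point in the strip has \<open>b = 0\<close>, so it is an integer, and then
  \<open>p = 1\<close>.\<close>

lemma strip_not_in_lattice:
  assumes "\<bar>Im z\<bar> < Im \<tau>" "exp (2 * of_real pi * \<i> * z) \<noteq> 1"
  shows "z \<notin> {of_int a + of_int b * \<tau> | a b :: int. True}"
proof
  assume "z \<in> {of_int a + of_int b * \<tau> | a b :: int. True}"
  then obtain a b :: int where z: "z = of_int a + of_int b * \<tau>"
    by blast
  have "\<bar>of_int b\<bar> * Im \<tau> < 1 * Im \<tau>"
    using assms(1) order_le_less_trans[OF abs_ge_zero assms(1)] by (simp add: z abs_mult)
  hence "b = 0"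
    using assms(1) by (subst (asm) mult_less_cancel_right) auto
  thus False
    using assms(2) by (simp add: z exp_eq_1)
qed

text \<open>Write \<open>theta1\<close> as \<open>g z * (1 - e z)\<close>. The second factor
  vanishes at 0 with derivative \<open>- 2 * pi * \<i>\<close>, so only \<open>g 0\<close> enters,
  and there all three products equal \<open>qpoch q q\<close>.\<close>

lemma theta1_bullet_0:
  assumes "Im \<tau> > 0"
  defines "q \<equiv> exp (2 * of_real pi * \<i> * \<tau>)"
  shows "theta1_bullet 0 \<tau> = - \<i> * exp (of_real pi * \<i> * \<tau> / 4) * qpoch q q ^ 3"
proof -
  have q: "norm q < 1"
    using norm_exp_2pi_i_less_1[OF assms(1)] by (simp add: q_def)
  define e where "e = (\<lambda>z::complex. exp (2 * of_real pi * \<i> * z))"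
  define g where "g = (\<lambda>z. \<i> * exp (of_real pi * \<i> * \<tau> / 4) * exp (- (of_real pi * \<i> * z)) * qpoch q q *
                         (qpoch (e z * q) q * qpoch (q / e z) q))"
  have theta: "theta1 z \<tau> = g z * (1 - e z)" for z
    using qpoch_rec[OF q, of "e z"]
    by (simp add: theta1_conv_qtheta[OF assms(1)] qtheta_def g_def e_def flip: q_def)
  have "g holomorphic_on UNIV"
    unfolding g_def e_def using q by (intro holomorphic_intros) auto
  hence "(g has_field_derivative deriv g 0) (at 0)"
    by (intro holomorphic_derivI) auto
  hence "((\<lambda>z. g z * (1 - e z)) has_field_derivative (g 0 * (- (2 * of_real pi * \<i>)))) (at 0)"
    unfolding e_def by (auto intro!: derivative_eq_intros)
  hence "deriv (\<lambda>z. theta1 z \<tau>) 0 = g 0 * (- (2 * of_real pi * \<i>))"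
    unfolding theta by (rule DERIV_imp_deriv)
  thus ?thesis
    by (simp add: theta1_bullet_def Dz_def g_def e_def power3_eq_cube)
qed

text \<open>The Kronecker identity in additive variables, cleared of theta denominators in
  preparation for comparing power series.\<close>

lemma kronecker_theta1:
  fixes \<tau> z u :: complex
  assumes z: "\<bar>Im z\<bar> < Im \<tau>" "exp (2 * of_real pi * \<i> * z) \<noteq> 1"
    and u: "\<bar>Im u\<bar> < Im \<tau>" "exp (2 * of_real pi * \<i> * u) \<noteq> 1"
  defines "q \<equiv> exp (2 * of_real pi * \<i> * \<tau>)"
    and "p \<equiv> exp (2 * of_real pi * \<i> * z)" and "y \<equiv> exp (2 * of_real pi * \<i> * u)"
  shows "theta1_bullet 0 \<tau> * theta1 (z + u) \<tau> =
           theta1 u \<tau> * theta1 z \<tau> *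
             (p / (p - 1) + 1 / (y - 1) - (lambert q p y - lambert q (1 / p) (1 / y)))"
proof -
  have \<tau>: "Im \<tau> > 0"
    using z by linarith
  have q: "q \<noteq> 0" "norm q < 1"
    using norm_exp_2pi_i_less_1[OF \<tau>] by (simp_all add: q_def)
  have p: "norm q < norm p" "norm p * norm q < 1" "p \<noteq> 1"
    using norm_nome_annulus[OF z(1)] z by (simp_all add: q_def p_def)
  have y: "norm q < norm y" "norm y * norm q < 1" "y \<noteq> 1"
    using norm_nome_annulus[OF u(1)] u by (simp_all add: q_def y_def)
  have nz: "qtheta q p \<noteq> 0" "qtheta q y \<noteq> 0"
    using qtheta_eq_0_annulus[OF q(2) p(1,2)] p qtheta_eq_0_annulus[OF q(2) y(1,2)] y by auto
  define c where "c = \<i> * exp (of_real pi * \<i> * \<tau> / 4)"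
  have py: "exp (2 * of_real pi * \<i> * (z + u)) = p * y"
    by (simp add: p_def y_def distrib_left exp_add)
  have add: "exp (- (of_real pi * \<i> * (z + u))) = exp (- (of_real pi * \<i> * z)) * exp (- (of_real pi * \<i> * u))"
    by (simp add: distrib_left flip: exp_add)
  have th: "theta1 u \<tau> = c * exp (- (of_real pi * \<i> * u)) * qpoch q q * qtheta q y"
           "theta1 z \<tau> = c * exp (- (of_real pi * \<i> * z)) * qpoch q q * qtheta q p"
           "theta1 (z + u) \<tau> = c * (exp (- (of_real pi * \<i> * z)) * exp (- (of_real pi * \<i> * u))) *
              qpoch q q * qtheta q (p * y)"
    unfolding theta1_conv_qtheta[OF \<tau>] q_def[symmetric] c_def[symmetric] py add
    by (simp_all add: p_def y_def)
  have tb: "theta1_bullet 0 \<tau> = - c * qpoch q q ^ 3"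
    unfolding theta1_bullet_0[OF \<tau>] q_def[symmetric] c_def by simp
  show ?thesis
    unfolding th tb kronecker_qtheta[OF q p y, symmetric]
    using nz by (simp add: power2_eq_square power3_eq_cube)
qed

section \<open>Generating function in the strip\<close>

text \<open>The factor \<open>n / fact n = 1 / fact (n - 1)\<close> and the exponent
  \<open>r^(n - 1)\<close> shift the Lambert coefficients by one place, hence the factor
  \<open>fps_X\<close>. The shift also turns \<open>(-1)^n\<close> into
  \<open>- (-1)^(n - 1)\<close>, which explains the difference on the right.\<close>

lemma J_series_fps:
  fixes \<tau> z :: complex
  assumes z: "\<bar>Im z\<bar> < Im \<tau>"
  defines "q \<equiv> exp (2 * of_real pi * \<i> * \<tau>)" and "p \<equiv> exp (2 * of_real pi * \<i> * z)"
  shows "Abs_fps (\<lambda>n. J_series n z \<tau> / fact n) =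
           fps_X * fps_const (p / (p - 1)) + fps_X / (fps_exp 1 - 1) -
           fps_X * (Abs_fps (\<lambda>n. lambert_coeff q p n / fact n) -
                    Abs_fps (\<lambda>n. (-1) ^ n * lambert_coeff q (1 / p) n / fact n))"
proof (rule fps_ext)
  fix n :: nat
  have \<tau>: "Im \<tau> > 0"
    using z by linarith
  have q: "q \<noteq> 0" "norm q < 1"
    using norm_exp_2pi_i_less_1[OF \<tau>] by (simp_all add: q_def)
  have p: "norm q < norm p" "norm (p * q) < 1" "p \<noteq> 0"
    using norm_nome_annulus[OF z] by (simp_all add: q_def p_def norm_mult)
  have inv_p: "norm (1 / p * q) < 1"
    using p(1,3) by (simp add: norm_divide norm_mult)
  show "fps_nth (Abs_fps (\<lambda>n. J_series n z \<tau> / fact n)) n = fps_nth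
          (fps_X * fps_const (p / (p - 1)) + fps_X / (fps_exp 1 - 1) -
           fps_X * (Abs_fps (\<lambda>n. lambert_coeff q p n / fact n) -
                    Abs_fps (\<lambda>n. (-1) ^ n * lambert_coeff q (1 / p) n / fact n))) n"
  proof (cases n)
    \<comment> \<open>The double series carries the factor \<open>of_nat 0\<close>, so its value is
      irrelevant here.\<close>
    case 0
    thus ?thesis
      by (simp add: J_series_def bernoulli_num_def)
  next
    case (Suc m)
    have "((\<lambda>z. (case z of (k, r) \<Rightarrow> of_nat r ^ m * p ^ k * q ^ (k * r)) +
             (-1) ^ n * (case z of (k, r) \<Rightarrow> of_nat r ^ m * (1 / p) ^ k * q ^ (k * r)))
            has_sum (lambert_coeff q p m + (-1) ^ n * lambert_coeff q (1 / p) m)) ({1..} \<times> {1..})"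
      using q p inv_p by (intro has_sum_add has_sum_cmult_right lambert_coeff_has_sum)
    also have "?this \<longleftrightarrow>
        ((\<lambda>(k, r). of_nat r powi (int n - 1) * (p ^ k + (-1) ^ n * inverse p ^ k) * q ^ (k * r))
            has_sum (lambert_coeff q p m + (-1) ^ n * lambert_coeff q (1 / p) m)) ({1..} \<times> {1..})"
      by (intro has_sum_cong) (auto simp: Suc algebra_simps inverse_eq_divide)
    finally have sum: "(\<Sum>\<^sub>\<infinity>(k, r)\<in>{1..} \<times> {1..}.
          of_nat r powi (int n - 1) * (p ^ k + (-1) ^ n * inverse p ^ k) * q ^ (k * r)) =
          lambert_coeff q p m + (-1) ^ n * lambert_coeff q (1 / p) m"
      by (rule infsumI)
    have "J_series n z \<tau> = (if n = 1 then p / (p - 1) else 0) + bernoulli_num n -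
            of_nat n * (lambert_coeff q p m + (-1) ^ n * lambert_coeff q (1 / p) m)"
      unfolding J_series_def Let_def q_def[symmetric] p_def[symmetric] sum by (rule refl)
    hence "J_series n z \<tau> / fact n = (if n = 1 then p / (p - 1) else 0) + bernoulli_num n / fact n -
            (of_nat n / fact n) * (lambert_coeff q p m + (-1) ^ n * lambert_coeff q (1 / p) m)"
      by (simp add: add_divide_distrib diff_divide_distrib)
    also have "of_nat n / fact n = (1 / fact m :: complex)"
      unfolding Suc fact_Suc by (simp del: of_nat_Suc)
    finally have "J_series n z \<tau> / fact n = (if n = 1 then p / (p - 1) else 0) +
            fps_nth (fps_X / (fps_exp 1 - 1)) n -
            (1 / fact m) * (lambert_coeff q p m + (-1) ^ n * lambert_coeff q (1 / p) m)"
      by (simp add: bernoulli_num_def)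
    thus ?thesis
      by (simp add: Suc ring_distribs diff_divide_distrib add_divide_distrib)
  qed
qed

section \<open>Taylor shift and the theta quotient as formal power series\<close>

lemma higher_Dz_holomorphic:
  assumes "f holomorphic_on UNIV"
  shows "(Dz ^^ k) f holomorphic_on UNIV"
proof (induction k)
  case (Suc k)
  have "(Dz ^^ Suc k) f = (\<lambda>z. deriv ((Dz ^^ k) f) z / (2 * of_real pi * \<i>))"
    by (simp add: Dz_def fun_eq_iff)
  thus ?case
    using Suc by (auto intro!: holomorphic_intros)
qed (use assms in auto)

lemma higher_Dz_conv_deriv:
  assumes "f holomorphic_on UNIV"
  shows "(Dz ^^ k) f z = (deriv ^^ k) f z / (2 * of_real pi * \<i>) ^ k"
proof (induction k arbitrary: z)
  case (Suc k)
  have "(deriv ^^ k) f field_differentiable at z"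
    using holomorphic_higher_deriv[OF assms open_UNIV, of k]
    by (simp add: holomorphic_on_imp_differentiable_at)
  hence "deriv (\<lambda>z. (deriv ^^ k) f z / (2 * of_real pi * \<i>) ^ k) z =
           deriv ((deriv ^^ k) f) z / (2 * of_real pi * \<i>) ^ k"
    by (rule deriv_cdivide_right)
  moreover have "(Dz ^^ k) f = (\<lambda>z. (deriv ^^ k) f z / (2 * of_real pi * \<i>) ^ k)"
    using Suc.IH by blast
  moreover have "(Dz ^^ Suc k) f z = deriv ((Dz ^^ k) f) z / (2 * of_real pi * \<i>)"
    by (simp add: Dz_def[of "(Dz ^^ k) f"])
  ultimately show ?case
    by simp
qed auto

text \<open>Taylor's theorem: \<open>exp (x * Dz)\<close> translates the argument by
  \<open>x / (2 * pi * \<i>)\<close>.\<close>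

lemma exp_xDz_conv_fps_expansion:
  assumes "f holomorphic_on UNIV"
  shows "exp_xDz f z = fps_expansion (\<lambda>x. f (z + x / (2 * of_real pi * \<i>))) 0"
proof (rule fps_ext)
  fix n :: nat
  have "(deriv ^^ n) (\<lambda>x. f (1 / (2 * of_real pi * \<i>) * x + z)) 0 =
          (1 / (2 * of_real pi * \<i>)) ^ n * (deriv ^^ n) f (1 / (2 * of_real pi * \<i>) * 0 + z)"
    by (rule higher_deriv_compose_linear'[OF assms open_UNIV open_UNIV]) auto
  moreover have "(\<lambda>x. f (1 / (2 * of_real pi * \<i>) * x + z)) = (\<lambda>x. f (z + x / (2 * of_real pi * \<i>)))"
    by (simp add: add.commute)
  ultimately show "fps_nth (exp_xDz f z) n = fps_nth (fps_expansion (\<lambda>x. f (z + x / (2 * of_real pi * \<i>))) 0) n"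
    by (simp add: exp_xDz_def fps_expansion_def higher_Dz_conv_deriv[OF assms] power_divide divide_simps)
qed

lemma theta1_0: "theta1 0 \<tau> = 0"
  by (simp add: theta1_def)

text \<open>The linear coefficient \<open>theta1_bullet 0 \<tau>\<close> is nonzero, so the
  denominator has order exactly 1 and the division of power series leaves no remainder.\<close>

lemma theta1_prefactor_mult:
  assumes "Im \<tau> > 0"
  defines "\<Theta> \<equiv> fps_expansion (\<lambda>x. theta1 (x / (2 * of_real pi * \<i>)) \<tau>) 0"
  shows "\<Theta> \<noteq> 0" and "theta1_prefactor \<tau> * \<Theta> = fps_X * fps_const (theta1_bullet 0 \<tau>)"
proof -
  have hol: "(\<lambda>z. theta1 z \<tau>) holomorphic_on UNIV"
    using assms by (intro holomorphic_intros)
  have "\<Theta> = exp_xDz (\<lambda>z. theta1 z \<tau>) 0"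
    unfolding exp_xDz_conv_fps_expansion[OF hol] \<Theta>_def by simp
  hence nth: "fps_nth \<Theta> 0 = 0" "fps_nth \<Theta> 1 = theta1_bullet 0 \<tau>"
    by (simp_all add: exp_xDz_def theta1_0 theta1_bullet_def)
  have bullet: "theta1_bullet 0 \<tau> \<noteq> 0"
    using theta1_bullet_0[OF assms(1)] qpoch_self_nonzero norm_exp_2pi_i_less_1[OF assms(1)]
    by simp
  show "\<Theta> \<noteq> 0"
    using nth bullet by force
  have "subdegree \<Theta> = 1"
    using nth bullet by (intro subdegreeI) auto
  hence "\<Theta> dvd fps_X * fps_const (theta1_bullet 0 \<tau>)"
    using bullet \<open>\<Theta> \<noteq> 0\<close> by (subst fps_dvd_iff) auto
  thus "theta1_prefactor \<tau> * \<Theta> = fps_X * fps_const (theta1_bullet 0 \<tau>)"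
    unfolding theta1_prefactor_def \<Theta>_def[symmetric] by (rule dvd_div_mult_self)
qed

text \<open>The Kronecker identity at \<open>u = x / (2 * pi * \<i>)\<close>, multiplied by
  \<open>x * (exp x - 1)\<close>, has no pole at \<open>x = 0\<close>. Both sides are expanded
  there, and the extra factors are cancelled among formal power series.\<close>

lemma J_series_generating_function:
  fixes \<tau> z :: complex
  assumes z: "\<bar>Im z\<bar> < Im \<tau>" "exp (2 * of_real pi * \<i> * z) \<noteq> 1"
  shows "Abs_fps (\<lambda>n. J_series n z \<tau> / fact n) =
           theta1_prefactor \<tau> * (exp_xDz (\<lambda>w. theta1 w \<tau>) z * fps_const (inverse (theta1 z \<tau>)))"
proof -
  have \<tau>: "Im \<tau> > 0"
    using z by linarith
  define q where "q = exp (2 * of_real pi * \<i> * \<tau>)"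
  define p where "p = exp (2 * of_real pi * \<i> * z)"
  have q: "q \<noteq> 0" "norm q < 1"
    using norm_exp_2pi_i_less_1[OF \<tau>] by (simp_all add: q_def)
  have p: "norm q < norm p" "norm (p * q) < 1" "p \<noteq> 0"
    using norm_nome_annulus[OF z(1)] by (simp_all add: q_def p_def norm_mult)
  have inv_p: "norm (1 / p * q) < 1"
    using p(1,3) by (simp add: norm_divide norm_mult)
  have theta_z: "theta1 z \<tau> \<noteq> 0"
    using theta1_nonzero[OF \<tau> strip_not_in_lattice[OF z]] .
  have hol: "(\<lambda>z. theta1 z \<tau>) holomorphic_on UNIV"
    using \<tau> by (intro holomorphic_intros)
  define \<Theta> where "\<Theta> = fps_expansion (\<lambda>x. theta1 (x / (2 * of_real pi * \<i>)) \<tau>) 0"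
  define T where "T = exp_xDz (\<lambda>w. theta1 w \<tau>) z"
  define L where "L = Abs_fps (\<lambda>n. lambert_coeff q p n / fact n) -
                      Abs_fps (\<lambda>n. (-1) ^ n * lambert_coeff q (1 / p) n / fact n)"
  define F where "F = fps_X * fps_const (p / (p - 1)) + fps_X / (fps_exp 1 - 1) - fps_X * L"
  have \<Theta>: "(\<lambda>x. theta1 (x / (2 * of_real pi * \<i>)) \<tau>) has_fps_expansion \<Theta>"
    unfolding \<Theta>_def using \<tau>
    by (intro has_fps_expansion_fps_expansion[of UNIV]) (auto intro!: holomorphic_intros)
  have T: "(\<lambda>x. theta1 (z + x / (2 * of_real pi * \<i>)) \<tau>) has_fps_expansion T"
    unfolding T_def exp_xDz_conv_fps_expansion[OF hol] using \<tau>
    by (intro has_fps_expansion_fps_expansion[of UNIV]) (auto intro!: holomorphic_intros)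
  have L: "(\<lambda>x. lambert q p (exp x) - lambert q (1 / p) (1 / exp x)) has_fps_expansion L"
    unfolding L_def
  proof (intro has_fps_expansion_diff)
    show "(\<lambda>x. lambert q p (exp x)) has_fps_expansion Abs_fps (\<lambda>n. lambert_coeff q p n / fact n)"
      using lambert_exp_has_fps_expansion[OF q p(2), of 1] by simp
    show "(\<lambda>x. lambert q (1 / p) (1 / exp x)) has_fps_expansion
            Abs_fps (\<lambda>n. (- 1) ^ n * lambert_coeff q (1 / p) n / fact n)"
      using lambert_exp_has_fps_expansion[OF q inv_p, of "-1"]
      by (simp add: exp_minus inverse_eq_divide)
  qed
  have lhs: "(\<lambda>x. theta1_bullet 0 \<tau> * theta1 (z + x / (2 * of_real pi * \<i>)) \<tau> * (x * (exp x - 1)))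
     has_fps_expansion (fps_const (theta1_bullet 0 \<tau>) * T * (fps_X * (fps_exp 1 - 1)))"
    by (intro has_fps_expansion_mult has_fps_expansion_diff T has_fps_expansion_const
          has_fps_expansion_1 has_fps_expansion_fps_X has_fps_expansion_exp1)
  have rhs: "(\<lambda>x. theta1 (x / (2 * of_real pi * \<i>)) \<tau> * theta1 z \<tau> *
       (x * (exp x - 1) * (p / (p - 1)) + x - x * (exp x - 1) *
         (lambert q p (exp x) - lambert q (1 / p) (1 / exp x))))
     has_fps_expansion (\<Theta> * fps_const (theta1 z \<tau>) *
       (fps_X * (fps_exp 1 - 1) * fps_const (p / (p - 1)) + fps_X - fps_X * (fps_exp 1 - 1) * L))"
    by (intro has_fps_expansion_mult has_fps_expansion_diff has_fps_expansion_add \<Theta> L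
          has_fps_expansion_const has_fps_expansion_1 has_fps_expansion_fps_X has_fps_expansion_exp1)
  \<comment> \<open>The bound \<open>Im \<tau>\<close> keeps \<open>u\<close> in the strip since
    \<open>2 * pi > 1\<close>; the bound 1 excludes the nonzero periods of
    \<open>exp\<close>.\<close>
  define X where "X = min 1 (Im \<tau>)"
  have "eventually (\<lambda>x. norm x < X) (nhds (0::complex))"
    using eventually_nhds_in_open[of "ball 0 X" "0::complex"] \<tau> by (simp add: dist_norm X_def)
  hence "eventually (\<lambda>x. theta1_bullet 0 \<tau> * theta1 (z + x / (2 * of_real pi * \<i>)) \<tau> * (x * (exp x - 1)) =
      theta1 (x / (2 * of_real pi * \<i>)) \<tau> * theta1 z \<tau> *
       (x * (exp x - 1) * (p / (p - 1)) + x - x * (exp x - 1) *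
         (lambert q p (exp x) - lambert q (1 / p) (1 / exp x)))) (nhds 0)"
  proof eventually_elim
    case (elim x)
    show ?case
    proof (cases "x = 0")
      case False
      define u where "u = x / (2 * of_real pi * \<i>)"
      have x: "2 * of_real pi * \<i> * u = x"
        by (simp add: u_def)
      have "\<bar>Im u\<bar> \<le> norm u"
        by (rule abs_Im_le_cmod)
      also have "norm u = norm x / (2 * pi)"
        by (simp add: u_def norm_divide norm_mult)
      also have "\<dots> \<le> norm x / 1"
        using pi_gt3 by (intro divide_left_mono) auto
      also have "\<dots> < Im \<tau>"
        using elim by (simp add: X_def)
      finally have u: "\<bar>Im u\<bar> < Im \<tau>" .
      have "exp x \<noteq> 1"
      proof
        assume "exp x = 1"
        then obtain n :: int where n: "Re x = 0" "Im x = of_int (2 * n) * pi"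
          by (auto simp: exp_eq_1)
        have "\<bar>Im x\<bar> < 1"
          using elim abs_Im_le_cmod[of x] by (simp add: X_def)
        hence "\<bar>of_int (2 * n)\<bar> * pi < 1"
          by (simp add: n(2) abs_mult)
        moreover have "\<bar>of_int (2 * n)\<bar> * pi \<ge> 1 * 1" if "n \<noteq> 0"
          using that pi_gt3 by (intro mult_mono) auto
        ultimately have "n = 0"
          by force
        with n False show False
          by (simp add: complex_eq_iff)
      qed
      hence "theta1_bullet 0 \<tau> * theta1 (z + u) \<tau> = theta1 u \<tau> * theta1 z \<tau> *
          (p / (p - 1) + 1 / (exp x - 1) - (lambert q p (exp x) - lambert q (1 / p) (1 / exp x)))"
        using kronecker_theta1[OF z u] by (simp add: x flip: q_def p_def)
      hence "theta1_bullet 0 \<tau> * theta1 (z + u) \<tau> * (x * (exp x - 1)) = theta1 u \<tau> * theta1 z \<tau> *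
          ((p / (p - 1) + 1 / (exp x - 1) - (lambert q p (exp x) - lambert q (1 / p) (1 / exp x))) *
          (x * (exp x - 1)))"
        by simp
      also have "(p / (p - 1) + 1 / (exp x - 1) - (lambert q p (exp x) - lambert q (1 / p) (1 / exp x))) *
          (x * (exp x - 1)) = x * (exp x - 1) * (p / (p - 1)) + 1 / (exp x - 1) * (x * (exp x - 1)) -
            x * (exp x - 1) * (lambert q p (exp x) - lambert q (1 / p) (1 / exp x))"
        by (simp only: ring_distribs mult_ac)
      also have "1 / (exp x - 1) * (x * (exp x - 1)) = x"
        using \<open>exp x \<noteq> 1\<close> by simp
      finally show ?thesis
        by (simp only: u_def)
    qed auto
  qed
  with lhs have "(\<lambda>x. theta1 (x / (2 * of_real pi * \<i>)) \<tau> * theta1 z \<tau> *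
       (x * (exp x - 1) * (p / (p - 1)) + x - x * (exp x - 1) *
         (lambert q p (exp x) - lambert q (1 / p) (1 / exp x))))
     has_fps_expansion (fps_const (theta1_bullet 0 \<tau>) * T * (fps_X * (fps_exp 1 - 1)))"
    by (subst (asm) has_fps_expansion_cong) auto
  from fps_expansion_unique_complex[OF this rhs]
  have eq: "fps_const (theta1_bullet 0 \<tau>) * T * (fps_X * (fps_exp 1 - 1)) = \<Theta> * fps_const (theta1 z \<tau>) *
       (fps_X * (fps_exp 1 - 1) * fps_const (p / (p - 1)) + fps_X - fps_X * (fps_exp 1 - 1) * L)" .
  \<comment> \<open>\<open>E\<close> has order 1, so \<open>fps_X / E\<close> is an exact quotient
    and the nonzero factor \<open>E\<close> cancels.\<close>
  define E where "E = (fps_exp 1 - 1 :: complex fps)"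
  have "fps_nth E 0 = 0" "fps_nth E 1 = 1"
    by (simp_all add: E_def)
  hence "subdegree E = 1" and [simp]: "E \<noteq> 0"
    by (auto intro!: subdegreeI)
  hence "fps_X / E * E = fps_X"
    by (intro dvd_div_mult_self) (auto simp: fps_dvd_iff)
  hence "fps_X * E * fps_const (p / (p - 1)) + fps_X - fps_X * E * L = F * E"
    by (simp add: F_def E_def[symmetric] ring_distribs mult_ac)
  with eq have "fps_const (theta1_bullet 0 \<tau>) * T * fps_X * E = \<Theta> * fps_const (theta1 z \<tau>) * F * E"
    by (simp add: E_def[symmetric] mult_ac)
  hence "fps_const (theta1_bullet 0 \<tau>) * T * fps_X = \<Theta> * fps_const (theta1 z \<tau>) * F"
    by simp
  hence "fps_const (inverse (theta1 z \<tau>)) * (theta1_prefactor \<tau> * \<Theta> * T) =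
           fps_const (inverse (theta1 z \<tau>)) * (fps_const (theta1 z \<tau>) * \<Theta> * F)"
    unfolding theta1_prefactor_mult(2)[OF \<tau>, folded \<Theta>_def] by (simp add: mult_ac)
  also have "\<dots> = (fps_const (inverse (theta1 z \<tau>)) * fps_const (theta1 z \<tau>)) * \<Theta> * F"
    by (simp only: mult_ac)
  also have "\<dots> = \<Theta> * F"
    using theta_z by simp
  finally have "\<Theta> * (theta1_prefactor \<tau> * (T * fps_const (inverse (theta1 z \<tau>)))) = \<Theta> * F"
    by (simp add: mult_ac)
  hence "theta1_prefactor \<tau> * (T * fps_const (inverse (theta1 z \<tau>))) = F"
    using theta1_prefactor_mult(1)[OF \<tau>] by (simp add: \<Theta>_def)
  thus ?thesis
    unfolding J_series_fps[OF z(1)] by (simp add: T_def F_def L_def p_def q_def)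
qed

section \<open>Meromorphic continuation\<close>

text \<open>The difference \<open>f - g\<close> need not be nicely meromorphic, so the identity
  theorem is applied to \<open>remove_sings\<close> of it. Then \<open>f\<close> and
  \<open>g\<close> agree near every point except perhaps at it, and niceness fixes the value there:
  the limit, or 0 at a pole.\<close>

lemma nicely_meromorphic_eq_on_open_imp_eq:
  assumes f: "f nicely_meromorphic_on UNIV" and g: "g nicely_meromorphic_on UNIV"
    and S: "open S" "S \<noteq> {}" "\<And>w. w \<in> S \<Longrightarrow> f w = g w"
  shows "f = g"
proof
  fix w :: complex
  define h where "h = remove_sings (\<lambda>w. f w - g w)"
  have mero: "(\<lambda>w. f w - g w) meromorphic_on UNIV"
    using f g by (auto simp: nicely_meromorphic_on_def intro!: meromorphic_intros)
  have zero: "h w = 0" if "w \<in> S" for w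
  proof -
    have "eventually (\<lambda>w. w \<in> S) (at w)"
      using S(1) that by (simp add: eventually_at_in_open')
    hence "eventually (\<lambda>w. f w - g w = 0) (at w)"
      by eventually_elim (use S in auto)
    thus ?thesis
      unfolding h_def by (intro remove_sings_eqI tendsto_eventually)
  qed
  have "h constant_on UNIV"
    using S zero by (intro constant_on_extend_nicely_meromorphic_on[of h UNIV S])
      (auto simp: h_def constant_on_def intro!: remove_sings_nicely_meromorphic mero)
  hence h0: "h w = 0" for w
    using S(2) zero by (auto simp: constant_on_def)
  have "eventually (\<lambda>v. h v = f v - g v) (at w)"
    unfolding h_def using mero
    by (intro eventually_remove_sings_eq_at) (auto intro: meromorphic_on_isolated_singularity meromorphic_on_subset)
  hence ev: "eventually (\<lambda>v. f v = g v) (at w)"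
    by eventually_elim (simp add: h0)
  have pole: "is_pole f w \<longleftrightarrow> is_pole g w"
    using ev by (intro is_pole_cong) auto
  have lim: "f \<midarrow>w\<rightarrow> c \<longleftrightarrow> g \<midarrow>w\<rightarrow> c" for c
    using ev by (intro tendsto_cong)
  show "f w = g w"
  proof (cases "is_pole f w")
    case True
    hence "\<not> f \<midarrow>w\<rightarrow> c" "\<not> g \<midarrow>w\<rightarrow> c" for c
      using pole not_tendsto_and_filterlim_at_infinity[OF at_neq_bot] by (auto simp: is_pole_def)
    thus ?thesis
      using f g by (metis UNIV_I nicely_meromorphic_on_def)
  next
    case False
    hence "f \<midarrow>w\<rightarrow> f w" "g \<midarrow>w\<rightarrow> g w"
      using pole f g by (auto simp: nicely_meromorphic_on_def)
    thus ?thesis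
      using lim LIM_unique by blast
  qed
qed

theorem theorem0p4:
  fixes \<tau> z :: complex
  assumes "Im \<tau> > 0"
    and "z \<notin> {of_int a + of_int b * \<tau> | a b :: int. True}"
  shows "Abs_fps (\<lambda>n. J n z \<tau> / fact n) =
           theta1_prefactor \<tau> * (exp_xDz (\<lambda>w. theta1 w \<tau>) z * fps_const (inverse (theta1 z \<tau>)))"
proof (rule fps_ext)
  fix n :: nat
  define R where "R = (\<lambda>z. theta1_prefactor \<tau> * (exp_xDz (\<lambda>w. theta1 w \<tau>) z * fps_const (inverse (theta1 z \<tau>))))"
  define g where "g = (\<lambda>z. fact n * fps_nth (R z) n)"
  \<comment> \<open>At a zero of \<open>theta1\<close> the convention \<open>inverse 0 = 0\<close>
    makes \<open>g\<close> vanish, which is wrong at a removable singularity;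
    \<open>remove_sings\<close> corrects this.\<close>
  define h where "h = remove_sings g"
  define S where "S = {w. \<bar>Im w\<bar> < Im \<tau> \<and> exp (2 * of_real pi * \<i> * w) \<noteq> 1}"
  have hol: "(\<lambda>w. theta1 w \<tau>) holomorphic_on UNIV"
    using assms by (intro holomorphic_intros)
  \<comment> \<open>Each coefficient is a finite sum of derivatives of \<open>theta1\<close> divided
    by \<open>theta1\<close>, hence meromorphic on the whole plane.\<close>
  have g_eq: "g = (\<lambda>z. fact n * (\<Sum>i=0..n. fps_nth (theta1_prefactor \<tau>) i *
                  ((Dz ^^ (n - i)) (\<lambda>w. theta1 w \<tau>) z / fact (n - i) * inverse (theta1 z \<tau>))))"
    by (simp add: g_def R_def fps_mult_nth[of "theta1_prefactor \<tau>"] exp_xDz_def)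
  have ana: "(\<lambda>w. theta1 w \<tau>) analytic_on A" "(Dz ^^ k) (\<lambda>w. theta1 w \<tau>) analytic_on A" for k A
    using hol higher_Dz_holomorphic[OF hol, of k] by (auto simp: analytic_on_holomorphic)
  have "g meromorphic_on UNIV"
    unfolding g_eq by (intro meromorphic_intros analytic_on_imp_meromorphic_on ana)
  hence h: "h nicely_meromorphic_on UNIV"
    unfolding h_def by (rule remove_sings_nicely_meromorphic)
  have h_eq: "h w = g w" if "w \<notin> {of_int a + of_int b * \<tau> | a b :: int. True}" for w
  proof -
    have "g analytic_on {w}"
      unfolding g_eq using theta1_nonzero[OF assms(1) that]
      by (intro analytic_intros ana) auto
    thus ?thesis
      by (simp add: h_def)
  qed
  have h_S: "h w = J_series n w \<tau>" if "w \<in> S" for w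
  proof -
    have w: "\<bar>Im w\<bar> < Im \<tau>" "exp (2 * of_real pi * \<i> * w) \<noteq> 1"
      using that by (auto simp: S_def)
    have "R w = Abs_fps (\<lambda>n. J_series n w \<tau> / fact n)"
      using J_series_generating_function[OF w] by (simp add: R_def)
    thus ?thesis
      using h_eq[OF strip_not_in_lattice[OF w]] by (simp add: g_def)
  qed
  have "open S"
    unfolding S_def by (intro open_Collect_conj open_Collect_less open_Collect_neq continuous_intros)
  \<comment> \<open>At this point \<open>p = -1\<close>.\<close>
  moreover have "1 / 2 \<in> S"
    using assms(1) by (simp add: S_def mult.commute)
  hence "S \<noteq> {}"
    by blast
  ultimately have unique: "f = h"
    if "f nicely_meromorphic_on UNIV" "\<forall>w. \<bar>Im w\<bar> < Im \<tau> \<and> exp (2 * of_real pi * \<i> * w) \<noteq> 1 \<longrightarrow> f w = J_series n w \<tau>" for f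
    using that h h_S by (intro nicely_meromorphic_eq_on_open_imp_eq[of f h S]) (simp_all add: S_def)
  have "(THE f. f nicely_meromorphic_on UNIV \<and>
        (\<forall>w. \<bar>Im w\<bar> < Im \<tau> \<and> exp (2 * of_real pi * \<i> * w) \<noteq> 1 \<longrightarrow> f w = J_series n w \<tau>)) = h"
  proof (rule the_equality)
    show "h nicely_meromorphic_on UNIV \<and>
        (\<forall>w. \<bar>Im w\<bar> < Im \<tau> \<and> exp (2 * of_real pi * \<i> * w) \<noteq> 1 \<longrightarrow> h w = J_series n w \<tau>)"
      using h h_S unfolding S_def by blast
  qed (use unique in blast)
  hence "J n z \<tau> = g z"
    unfolding J_def using h_eq[OF assms(2)] by (simp only:)
  thus "fps_nth (Abs_fps (\<lambda>n. J n z \<tau> / fact n)) n =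
          fps_nth (theta1_prefactor \<tau> * (exp_xDz (\<lambda>w. theta1 w \<tau>) z * fps_const (inverse (theta1 z \<tau>)))) n"
    by (simp add: g_def R_def)
qed

end
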